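(* Let $(M,J,g)$ be an almost Hermitian manifold with fundamental form $F=g(J\cdot,\cdot)$. Let $T$ be the torsion of its Chern connection, $\theta$ its torsion $1$-form, $t$ the anti-symmetrization of $T$, $s$ its third scalar curvature and $s^g$ its Riemannian scalar curvature. Then $$2s-s^g = |T|^2-\tfrac92|t|^2-2\,\delta^g\theta - |\theta|^2 .$$
   Context: $M$ has real dimension $m=2n$, $J^2=-1$, $J$ is $g$-orthogonal. The Chern connection $\nabla$ is the unique connection on $TM$ with $\nabla g=0$, $\nabla J=0$ whose torsion $T_{XY}=\nabla_XY-\nabla_YX-[X,Y]$ satisfies $T_{JX,JY}=-T_{XY}$. Its curvature is $R_{XY}=[\nabla_X,\nabla_Y]-\nabla_{[X,Y]}$. For a local $g$-orthonormal frame $(e_i)_{i=1}^m$ with $e_{2\alpha}=Je_{2\alpha-1}$: Third scalar curvature: $s=\frac12\sum_{i,j}g(R_{e_i,e_j}e_j,e_i)$. The Riemannian scalar curvature $s^g$ is the usual scalar curvature of the Levi-Civita connection. Torsion $1$-form: $\theta=\Lambda(dF)$, i.e. $\theta(X)=\frac12\sum_i dF(e_i,Je_i,X)$; equivalently $\theta(X)=\operatorname{tr}(Z\mapsto T_{XZ})$. $t$ is the $3$-form $t_{XYZ}=\frac13\big(g(X,T_{YZ})+g(Z,T_{XY})+g(Y,T_{ZX})\big)$. Norms: $|T|^2=\frac12\sum_{i,j}|T_{e_ie_j}|^2$ (norm of a $TM$-valued $2$-form), $|t|^2=\frac16\sum_{i,j,k}t_{e_ie_je_k}^2$ (usual norm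 of a $3$-form), $|\theta|^2=\sum_i\theta(e_i)^2$. $\delta^g$ is the codifferential with respect to $g$. *)

theory Defs
  imports "HOL-Analysis.Analysis" "HOL-Library.Function_Algebras"
begin

section \<open>Smooth manifolds\<close>

text \<open>Real-linear operations on real functions, tangent vectors and vector fields are pointwise;
  addition comes from \<^theory>\<open>HOL-Library.Function_Algebras\<close>.\<close>

text \<open>Only meant for open \<open>S\<close>: all iterated directional derivatives up to order \<open>k\<close> exist, are
  continuous, and are (for order below \<open>k\<close>) Frechet differentiable.\<close>

primrec Ck_on :: "nat \<Rightarrow> 'e::euclidean_space set \<Rightarrow> ('e \<Rightarrow> 'b::real_normed_vector) \<Rightarrow> bool" where
  "Ck_on 0 S f \<longleftrightarrow> continuous_on S f"
| "Ck_on (Suc k) S f \<longleftrightarrow> (\<forall>x\<in>S. f differentiable (at x)) \<and>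
     (\<forall>v. Ck_on k S (\<lambda>x. frechet_derivative f (at x) v))"

definition smooth_on :: "'e::euclidean_space set \<Rightarrow> ('e \<Rightarrow> 'b::real_normed_vector) \<Rightarrow> bool" where
  "smooth_on S f \<longleftrightarrow> (\<forall>k. Ck_on k S f)"

type_synonym ('a, 'e) chart = "'a set \<times> ('a \<Rightarrow> 'e)"

text \<open>The manifold is the whole (Hausdorff, second countable) type \<open>'a\<close>; its smooth structure is
  given by a smooth atlas modelled on \<open>'e\<close>, so its dimension is \<open>DIM('e)\<close>.\<close>

definition smooth_atlas ::
  "('a::{t2_space,second_countable_topology}, 'e::euclidean_space) chart set \<Rightarrow> bool" where
  "smooth_atlas A \<longleftrightarrow>
     (\<Union>(V, \<phi>)\<in>A. V) = UNIV \<and>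
     (\<forall>(V, \<phi>)\<in>A. open V \<and> open (\<phi> ` V) \<and> homeomorphism V (\<phi> ` V) \<phi> (inv_into V \<phi>)) \<and>
     (\<forall>(V, \<phi>)\<in>A. \<forall>(W, \<psi>)\<in>A. smooth_on (\<phi> ` (V \<inter> W)) (\<psi> \<circ> inv_into V \<phi>))"

definition smooth_fun :: "('a::topological_space, 'e::euclidean_space) chart set \<Rightarrow>
    'a set \<Rightarrow> ('a \<Rightarrow> real) \<Rightarrow> bool" where
  "smooth_fun A U f \<longleftrightarrow> (\<forall>(V, \<phi>)\<in>A. smooth_on (\<phi> ` (U \<inter> V)) (f \<circ> inv_into V \<phi>))"

definition smooth_near :: "('a::topological_space, 'e::euclidean_space) chart set \<Rightarrow>
    'a \<Rightarrow> ('a \<Rightarrow> real) \<Rightarrow> bool" where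
  "smooth_near A p f \<longleftrightarrow> (\<exists>U. open U \<and> p \<in> U \<and> smooth_fun A U f)"


section \<open>Tangent vectors and vector fields\<close>

text \<open>A tangent vector at \<open>p\<close> is a derivation of the algebra of germs at \<open>p\<close> of smooth functions.
  HOL functions being total, a derivation is given the value \<open>0\<close> on functions that are not smooth
  near \<open>p\<close>, so that equality of tangent vectors is equality in HOL.\<close>

type_synonym 'a tvec = "('a \<Rightarrow> real) \<Rightarrow> real"
type_synonym 'a vfield = "'a \<Rightarrow> 'a tvec"

definition scale_tvec :: "real \<Rightarrow> 'a tvec \<Rightarrow> 'a tvec"  (infixr "*\<^sub>t" 75) where
  "c *\<^sub>t v = (\<lambda>f. c * v f)"

definition tangent_space :: "('a::topological_space, 'e::euclidean_space) chart set \<Rightarrow>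
    'a \<Rightarrow> 'a tvec set" where
  "tangent_space A p = {v.
     (\<forall>f h. smooth_near A p f \<and> smooth_near A p h \<longrightarrow>
        v (\<lambda>q. f q + h q) = v f + v h \<and>
        v (\<lambda>q. f q * h q) = v f * h p + f p * v h) \<and>
     (\<forall>c f. smooth_near A p f \<longrightarrow> v (\<lambda>q. c * f q) = c * v f) \<and>
     (\<forall>f h U. smooth_near A p f \<and> open U \<and> p \<in> U \<and> (\<forall>q\<in>U. f q = h q) \<longrightarrow> v f = v h) \<and>
     (\<forall>f. \<not> smooth_near A p f \<longrightarrow> v f = 0)}"

definition smooth_vfield :: "('a::topological_space, 'e::euclidean_space) chart set \<Rightarrow>
    'a set \<Rightarrow> 'a vfield \<Rightarrow> bool" where
  "smooth_vfield A U X \<longleftrightarrow>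
     (\<forall>p\<in>U. X p \<in> tangent_space A p) \<and>
     (\<forall>V f. open V \<and> V \<subseteq> U \<and> smooth_fun A V f \<longrightarrow> smooth_fun A V (\<lambda>p. X p f))"

definition lie_bracket :: "('a::topological_space, 'e::euclidean_space) chart set \<Rightarrow>
    'a vfield \<Rightarrow> 'a vfield \<Rightarrow> 'a vfield" where
  "lie_bracket A X Y = (\<lambda>p f. if smooth_near A p f
     then X p (\<lambda>q. Y q f) - Y p (\<lambda>q. X q f) else 0)"


section \<open>Almost Hermitian structures\<close>

definition apply_field :: "('a \<Rightarrow> 'a tvec \<Rightarrow> 'a tvec) \<Rightarrow> 'a vfield \<Rightarrow> 'a vfield" where
  "apply_field J X = (\<lambda>p. J p (X p))"

definition apply_metric :: "('a \<Rightarrow> 'a tvec \<Rightarrow> 'a tvec \<Rightarrow> real) \<Rightarrow>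
    'a vfield \<Rightarrow> 'a vfield \<Rightarrow> 'a \<Rightarrow> real" where
  "apply_metric g X Y = (\<lambda>p. g p (X p) (Y p))"

definition almost_complex_structure :: "('a::topological_space, 'e::euclidean_space) chart set \<Rightarrow>
    ('a \<Rightarrow> 'a tvec \<Rightarrow> 'a tvec) \<Rightarrow> bool" where
  "almost_complex_structure A J \<longleftrightarrow>
     (\<forall>p. \<forall>v\<in>tangent_space A p. J p v \<in> tangent_space A p \<and> J p (J p v) = - v \<and>
        (\<forall>w\<in>tangent_space A p. J p (v + w) = J p v + J p w) \<and>
        (\<forall>c. J p (c *\<^sub>t v) = c *\<^sub>t J p v)) \<and>
     (\<forall>U X. open U \<and> smooth_vfield A U X \<longrightarrow> smooth_vfield A U (apply_field J X))"

definition riemannian_metric :: "('a::topological_space, 'e::euclidean_space) chart set \<Rightarrow>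
    ('a \<Rightarrow> 'a tvec \<Rightarrow> 'a tvec \<Rightarrow> real) \<Rightarrow> bool" where
  "riemannian_metric A g \<longleftrightarrow>
     (\<forall>p. \<forall>u\<in>tangent_space A p. (u \<noteq> 0 \<longrightarrow> g p u u > 0) \<and>
        (\<forall>v\<in>tangent_space A p. g p u v = g p v u \<and>
           (\<forall>c. g p (c *\<^sub>t u) v = c * g p u v) \<and>
           (\<forall>w\<in>tangent_space A p. g p (u + v) w = g p u w + g p v w))) \<and>
     (\<forall>U X Y. open U \<and> smooth_vfield A U X \<and> smooth_vfield A U Y \<longrightarrow>
        smooth_fun A U (apply_metric g X Y))"

definition almost_hermitian :: "('a::topological_space, 'e::euclidean_space) chart set \<Rightarrow>
    ('a \<Rightarrow> 'a tvec \<Rightarrow> 'a tvec) \<Rightarrow> ('a \<Rightarrow> 'a tvec \<Rightarrow> 'a tvec \<Rightarrow> real) \<Rightarrow> bool" where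
  "almost_hermitian A J g \<longleftrightarrow> almost_complex_structure A J \<and> riemannian_metric A g \<and>
     (\<forall>p. \<forall>v\<in>tangent_space A p. \<forall>w\<in>tangent_space A p. g p (J p v) (J p w) = g p v w)"

definition fundamental_form :: "('a \<Rightarrow> 'a tvec \<Rightarrow> 'a tvec) \<Rightarrow>
    ('a \<Rightarrow> 'a tvec \<Rightarrow> 'a tvec \<Rightarrow> real) \<Rightarrow> 'a vfield \<Rightarrow> 'a vfield \<Rightarrow> 'a \<Rightarrow> real" where
  "fundamental_form J g X Y = apply_metric g (apply_field J X) Y"

text \<open>Exterior derivative of a 2-form, by Cartan's formula (normalised without a factor
  \<open>1/3\<close>).\<close>

definition ext_deriv2 :: "('a::topological_space, 'e::euclidean_space) chart set \<Rightarrow>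
    ('a vfield \<Rightarrow> 'a vfield \<Rightarrow> 'a \<Rightarrow> real) \<Rightarrow>
    'a vfield \<Rightarrow> 'a vfield \<Rightarrow> 'a vfield \<Rightarrow> 'a \<Rightarrow> real" where
  "ext_deriv2 A \<omega> X Y Z p =
     X p (\<omega> Y Z) + Y p (\<omega> Z X) + Z p (\<omega> X Y)
     - \<omega> (lie_bracket A X Y) Z p - \<omega> (lie_bracket A Y Z) X p - \<omega> (lie_bracket A Z X) Y p"


section \<open>Connections on the tangent bundle\<close>

text \<open>\<open>D p v Y\<close> is the covariant derivative at \<open>p\<close>, in the direction of the tangent vector \<open>v\<close> at
  \<open>p\<close>, of a vector field \<open>Y\<close> that is smooth on some open neighbourhood of \<open>p\<close>.\<close>

type_synonym 'a conn = "'a \<Rightarrow> 'a tvec \<Rightarrow> 'a vfield \<Rightarrow> 'a tvec"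

definition cov_deriv :: "'a conn \<Rightarrow> 'a vfield \<Rightarrow> 'a vfield \<Rightarrow> 'a vfield" where
  "cov_deriv D X Y = (\<lambda>p. D p (X p) Y)"

definition connection :: "('a::topological_space, 'e::euclidean_space) chart set \<Rightarrow>
    'a conn \<Rightarrow> bool" where
  "connection A D \<longleftrightarrow> (\<forall>U. open U \<longrightarrow>
     (\<forall>X Y. smooth_vfield A U X \<and> smooth_vfield A U Y \<longrightarrow> smooth_vfield A U (cov_deriv D X Y)) \<and>
     (\<forall>p\<in>U. \<forall>v\<in>tangent_space A p. \<forall>Y. smooth_vfield A U Y \<longrightarrow>
        D p v Y \<in> tangent_space A p \<and>
        (\<forall>w\<in>tangent_space A p. D p (v + w) Y = D p v Y + D p w Y) \<and>
        (\<forall>c. D p (c *\<^sub>t v) Y = c *\<^sub>t D p v Y) \<and>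
        (\<forall>Z. smooth_vfield A U Z \<longrightarrow> D p v (Y + Z) = D p v Y + D p v Z) \<and>
        (\<forall>f. smooth_fun A U f \<longrightarrow> D p v (\<lambda>q. f q *\<^sub>t Y q) = v f *\<^sub>t Y p + f p *\<^sub>t D p v Y) \<and>
        (\<forall>Z. smooth_vfield A U Z \<and> (\<forall>q\<in>U. Y q = Z q) \<longrightarrow> D p v Y = D p v Z)))"

definition torsion :: "('a::topological_space, 'e::euclidean_space) chart set \<Rightarrow>
    'a conn \<Rightarrow> 'a vfield \<Rightarrow> 'a vfield \<Rightarrow> 'a vfield" where
  "torsion A D X Y = cov_deriv D X Y - cov_deriv D Y X - lie_bracket A X Y"

definition curvature :: "('a::topological_space, 'e::euclidean_space) chart set \<Rightarrow>
    'a conn \<Rightarrow> 'a vfield \<Rightarrow> 'a vfield \<Rightarrow> 'a vfield \<Rightarrow> 'a vfield" where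
  "curvature A D X Y Z =
     cov_deriv D X (cov_deriv D Y Z) - cov_deriv D Y (cov_deriv D X Z)
     - cov_deriv D (lie_bracket A X Y) Z"

definition metric_connection :: "('a::topological_space, 'e::euclidean_space) chart set \<Rightarrow>
    ('a \<Rightarrow> 'a tvec \<Rightarrow> 'a tvec \<Rightarrow> real) \<Rightarrow> 'a conn \<Rightarrow> bool" where
  "metric_connection A g D \<longleftrightarrow> connection A D \<and>
     (\<forall>U X Y Z. open U \<and> smooth_vfield A U X \<and> smooth_vfield A U Y \<and> smooth_vfield A U Z \<longrightarrow>
        (\<forall>p\<in>U. X p (apply_metric g Y Z) =
           apply_metric g (cov_deriv D X Y) Z p + apply_metric g Y (cov_deriv D X Z) p))"

definition levi_civita_connection :: "('a::topological_space, 'e::euclidean_space) chart set \<Rightarrow>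
    ('a \<Rightarrow> 'a tvec \<Rightarrow> 'a tvec \<Rightarrow> real) \<Rightarrow> 'a conn \<Rightarrow> bool" where
  "levi_civita_connection A g D \<longleftrightarrow> metric_connection A g D \<and>
     (\<forall>U X Y. open U \<and> smooth_vfield A U X \<and> smooth_vfield A U Y \<longrightarrow>
        (\<forall>p\<in>U. torsion A D X Y p = 0))"

definition chern_connection :: "('a::topological_space, 'e::euclidean_space) chart set \<Rightarrow>
    ('a \<Rightarrow> 'a tvec \<Rightarrow> 'a tvec) \<Rightarrow> ('a \<Rightarrow> 'a tvec \<Rightarrow> 'a tvec \<Rightarrow> real) \<Rightarrow> 'a conn \<Rightarrow> bool" where
  "chern_connection A J g D \<longleftrightarrow> metric_connection A g D \<and>
     (\<forall>U X Y. open U \<and> smooth_vfield A U X \<and> smooth_vfield A U Y \<longrightarrow>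
        (\<forall>p\<in>U. cov_deriv D X (apply_field J Y) p = J p (cov_deriv D X Y p)) \<and>
        (\<forall>p\<in>U. torsion A D (apply_field J X) (apply_field J Y) p = - torsion A D X Y p))"


section \<open>Quantities in an adapted frame\<close>

text \<open>A smooth local frame on \<open>U\<close>, \<open>g\<close>-orthonormal, indexed by \<open>1, \<dots>, 2n\<close>, with
  \<open>e (2 \<alpha>) = J (e (2 \<alpha> - 1))\<close>. The last clause (the \<open>e i p\<close> span the tangent space) is part of
  being a frame. The quantities below are written, as usual, with the help of such a frame, although
  they do not depend on it.\<close>

definition adapted_frame :: "('a::topological_space, 'e::euclidean_space) chart set \<Rightarrow>
    ('a \<Rightarrow> 'a tvec \<Rightarrow> 'a tvec) \<Rightarrow> ('a \<Rightarrow> 'a tvec \<Rightarrow> 'a tvec \<Rightarrow> real) \<Rightarrow> nat \<Rightarrow>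
    'a set \<Rightarrow> (nat \<Rightarrow> 'a vfield) \<Rightarrow> bool" where
  "adapted_frame A J g n U e \<longleftrightarrow> open U \<and>
     (\<forall>i\<in>{1..2*n}. smooth_vfield A U (e i)) \<and>
     (\<forall>p\<in>U.
        (\<forall>i\<in>{1..2*n}. \<forall>j\<in>{1..2*n}. g p (e i p) (e j p) = (if i = j then 1 else 0)) \<and>
        (\<forall>\<alpha>\<in>{1..n}. e (2*\<alpha>) p = J p (e (2*\<alpha> - 1) p)) \<and>
        (\<forall>v\<in>tangent_space A p. \<exists>a. v = (\<Sum>i=1..2*n. a i *\<^sub>t e i p)))"

context
  fixes A :: "('a::topological_space, 'e::euclidean_space) chart set"
    and J :: "'a \<Rightarrow> 'a tvec \<Rightarrow> 'a tvec"
    and g :: "'a \<Rightarrow> 'a tvec \<Rightarrow> 'a tvec \<Rightarrow> real"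
    and n :: nat
    and e :: "nat \<Rightarrow> 'a vfield"
begin

definition riemannian_scalar :: "'a conn \<Rightarrow> 'a \<Rightarrow> real" where
  "riemannian_scalar LC p =
     (\<Sum>i=1..2*n. \<Sum>j=1..2*n. apply_metric g (curvature A LC (e i) (e j) (e j)) (e i) p)"

definition third_scalar :: "'a conn \<Rightarrow> 'a \<Rightarrow> real" where
  "third_scalar D p =
     1/2 * (\<Sum>i=1..2*n. \<Sum>j=1..2*n. apply_metric g (curvature A D (e i) (e j) (e j)) (e i) p)"

text \<open>\<open>\<theta> = \<Lambda>(dF)\<close>\<close>

definition torsion_form :: "'a vfield \<Rightarrow> 'a \<Rightarrow> real" where
  "torsion_form X p = 1/2 * (\<Sum>i=1..2*n.
     ext_deriv2 A (fundamental_form J g) (e i) (apply_field J (e i)) X p)"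

definition torsion_antisym :: "'a conn \<Rightarrow> 'a vfield \<Rightarrow> 'a vfield \<Rightarrow> 'a vfield \<Rightarrow> 'a \<Rightarrow> real" where
  "torsion_antisym D X Y Z p = 1/3 *
     (apply_metric g X (torsion A D Y Z) p + apply_metric g Z (torsion A D X Y) p
      + apply_metric g Y (torsion A D Z X) p)"

definition torsion_norm2 :: "'a conn \<Rightarrow> 'a \<Rightarrow> real" where
  "torsion_norm2 D p = 1/2 * (\<Sum>i=1..2*n. \<Sum>j=1..2*n.
     apply_metric g (torsion A D (e i) (e j)) (torsion A D (e i) (e j)) p)"

definition norm2_3form :: "('a vfield \<Rightarrow> 'a vfield \<Rightarrow> 'a vfield \<Rightarrow> 'a \<Rightarrow> real) \<Rightarrow> 'a \<Rightarrow> real" where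
  "norm2_3form \<tau> p =
     1/6 * (\<Sum>i=1..2*n. \<Sum>j=1..2*n. \<Sum>k=1..2*n. (\<tau> (e i) (e j) (e k) p)\<^sup>2)"

definition norm2_1form :: "('a vfield \<Rightarrow> 'a \<Rightarrow> real) \<Rightarrow> 'a \<Rightarrow> real" where
  "norm2_1form \<alpha> p = (\<Sum>i=1..2*n. (\<alpha> (e i) p)\<^sup>2)"

text \<open>Codifferential of a 1-form: \<open>\<delta>\<alpha> = - (\<Sum>i. (D\<^bsub>e i\<^esub> \<alpha>) (e i))\<close> with \<open>D\<close> the Levi-Civita
  connection, where \<open>(D\<^bsub>X\<^esub> \<alpha>) Y = X (\<alpha> Y) - \<alpha> (D\<^bsub>X\<^esub> Y)\<close>.\<close>

definition codifferential :: "'a conn \<Rightarrow> ('a vfield \<Rightarrow> 'a \<Rightarrow> real) \<Rightarrow> 'a \<Rightarrow> real" where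
  "codifferential LC \<alpha> p =
     - (\<Sum>i=1..2*n. e i p (\<alpha> (e i)) - \<alpha> (cov_deriv LC (e i) (e i)) p)"

end

end

theory Submission
  imports Defs
begin

text \<open>
  The formula is true for every connection \<open>D\<close> with \<open>Dg = 0\<close> when \<open>\<theta>\<close> is the trace of its torsion. The
  almost complex structure enters by identifying this trace, for the Chern connection, with \<open>\<Lambda>(dF)\<close>.

  Write \<open>C\<^sub>i\<^sub>j\<^sub>k\<close> and \<open>L\<^sub>i\<^sub>j\<^sub>k\<close> for the coefficients of \<open>D\<close> and of the Levi-Civita connection in the
  orthonormal frame, and \<open>a = C - L\<close>. All three are skew in the last two indices, and since the
  Levi-Civita connection has no torsion, \<open>T\<^sub>i\<^sub>j\<^sub>k = a\<^sub>i\<^sub>j\<^sub>k - a\<^sub>j\<^sub>i\<^sub>k\<close> and the bracket of \<open>e\<^sub>i\<close>, \<open>e\<^sub>j\<close> has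
  components \<open>L\<^sub>i\<^sub>j\<^sub>k - L\<^sub>j\<^sub>i\<^sub>k\<close>. Moving derivatives off the covariant derivatives with \<open>Dg = 0\<close> expresses
  the full trace of the curvature by the derivatives \<open>e\<^sub>i(C\<^sub>j\<^sub>j\<^sub>i)\<close> and by quadratic terms
  (\<open>scalar_curvature_frame\<close>). Subtract the same formula for the Levi-Civita connection, and let
  \<open>c\<^sub>k = \<Sum>\<^sub>j C\<^sub>j\<^sub>j\<^sub>k\<close>, \<open>l\<^sub>k = \<Sum>\<^sub>j L\<^sub>j\<^sub>j\<^sub>k\<close>, so that \<open>\<theta>\<^sub>k = \<Sum>\<^sub>j a\<^sub>j\<^sub>j\<^sub>k = c\<^sub>k - l\<^sub>k\<close>. The squares of the traces give
  \<open>\<Sum>\<^sub>k (l\<^sub>k\<^sup>2 - c\<^sub>k\<^sup>2) = - 2 \<Sum>\<^sub>k l\<^sub>k \<theta>\<^sub>k - |\<theta>|\<^sup>2\<close>, and the first of these sums completes the derivative terms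
  \<open>2 \<Sum>\<^sub>i e\<^sub>i(\<theta>\<^sub>i)\<close> to \<open>-2 \<delta>\<theta>\<close>. The remaining quadratic terms collapse to \<open>\<Sum> a\<^sub>i\<^sub>j\<^sub>k a\<^sub>j\<^sub>i\<^sub>k\<close>
  (\<open>connection_coefficients_quadratic\<close>), and this sum is determined by the torsion: it equals
  \<open>|T|\<^sup>2 - 9/2 |t|\<^sup>2\<close> (\<open>contorsion_quadratic\<close>).

  For the Chern connection, \<open>DJ = 0\<close> and \<open>Dg = 0\<close> give
  \<open>dF(X,Y,Z) = g(JT(X,Y),Z) + g(JT(Y,Z),X) + g(JT(Z,X),Y)\<close>. In \<open>\<Lambda>(dF)\<close> the terms \<open>T(e\<^sub>i,Je\<^sub>i)\<close> vanish,
  since \<open>T(JX,JY) = -T(X,Y)\<close>, and the other two are the trace of \<open>T\<close> over the frames \<open>(e\<^sub>i)\<close> and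
  \<open>(Je\<^sub>i)\<close>, which are the same up to order and sign (\<open>torsion_form_eq_trace\<close>).
\<close>

section \<open>Linear combinations of smooth functions\<close>

text \<open>Openness of \<open>S\<close> makes the derivative at a point of \<open>S\<close> depend only on the values on \<open>S\<close>.\<close>

lemma Ck_on_cong:
  fixes f h :: "'e::euclidean_space \<Rightarrow> 'b::real_normed_vector"
  assumes "open S" "\<And>x. x \<in> S \<Longrightarrow> f x = h x" "Ck_on k S f"
  shows "Ck_on k S h"
  using assms(2,3)
proof (induction k arbitrary: f h)
  case 0
  then show ?case using continuous_on_cong[of S S f h] by simp
next
  case (Suc k)
  have d: "f differentiable (at x)" if "x \<in> S" for x
    using Suc.prems(2) that by simp
  have dh: "h differentiable (at x)" if "x \<in> S" for x
    using d[OF that] has_derivative_transform_within_open[where f = f and g = h,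
        OF _ \<open>open S\<close> that Suc.prems(1)]
    unfolding differentiable_def by blast
  have eq: "frechet_derivative f (at x) = frechet_derivative h (at x)" if "x \<in> S" for x
    using frechet_derivative_transform_within_open[OF d[OF that] \<open>open S\<close> that Suc.prems(1)] by blast
  have "Ck_on k S (\<lambda>x. frechet_derivative h (at x) v)" for v
    using Suc.IH[of "\<lambda>x. frechet_derivative f (at x) v"] eq Suc.prems(2) by simp
  with dh show ?case by simp
qed

lemma Ck_on_const: "Ck_on k S (\<lambda>x. c)"
  by (induction k arbitrary: c) auto

lemma Ck_on_add_scaled:
  fixes f h :: "'e::euclidean_space \<Rightarrow> real"
  assumes "open S" "Ck_on k S f" "Ck_on k S h"
  shows "Ck_on k S (\<lambda>x. f x + c * h x)"
  using assms(2,3)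
proof (induction k arbitrary: f h)
  case 0
  then show ?case by (auto intro!: continuous_intros)
next
  case (Suc k)
  have d: "((\<lambda>x. f x + c * h x) has_derivative
      (\<lambda>v. frechet_derivative f (at x) v + c * frechet_derivative h (at x) v)) (at x)"
    if "x \<in> S" for x
    using Suc.prems that
    by (intro has_derivative_add has_derivative_mult_right) (auto simp: frechet_derivative_works)
  have "Ck_on k S (\<lambda>x. frechet_derivative (\<lambda>x. f x + c * h x) (at x) v)" for v
  proof (rule Ck_on_cong[OF \<open>open S\<close>])
    show "Ck_on k S (\<lambda>x. frechet_derivative f (at x) v + c * frechet_derivative h (at x) v)"
      by (rule Suc.IH) (use Suc.prems in simp_all)
  next
    fix x assume "x \<in> S"
    show "frechet_derivative f (at x) v + c * frechet_derivative h (at x) v =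
        frechet_derivative (\<lambda>x. f x + c * h x) (at x) v"
      using frechet_derivative_at[OF d[OF \<open>x \<in> S\<close>]] by (rule fun_cong)
  qed
  moreover have "(\<lambda>x. f x + c * h x) differentiable (at x)" if "x \<in> S" for x
    using d[OF that] unfolding differentiable_def by blast
  ultimately show ?case by simp
qed

lemma open_chart_image:
  assumes "smooth_atlas A" "(V, \<phi>) \<in> A" "open U"
  shows "open (\<phi> ` (U \<inter> V))"
proof -
  have V: "open V" "open (\<phi> ` V)" and h: "homeomorphism V (\<phi> ` V) \<phi> (inv_into V \<phi>)"
    using assms(1,2) unfolding smooth_atlas_def by blast+
  have "openin (top_of_set V) (U \<inter> V)"
    using openin_open_Int[OF \<open>open U\<close>, of V] by (simp add: Int_commute)
  then have "openin (top_of_set (\<phi> ` V)) (\<phi> ` (U \<inter> V))"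
    using homeomorphism_imp_open_map[OF h] by blast
  then show ?thesis using V(2) openin_open_trans by blast
qed

lemma smooth_fun_const: "smooth_fun A U (\<lambda>q. c)"
  unfolding smooth_fun_def smooth_on_def by (auto simp: o_def Ck_on_const)

text \<open>The atlas enters because derivatives in a chart are local only on open coordinate domains.\<close>

lemma smooth_fun_add_scaled:
  assumes "smooth_atlas A" "open U" "smooth_fun A U f" "smooth_fun A U h"
  shows "smooth_fun A U (\<lambda>q. f q + c * h q)"
  unfolding smooth_fun_def smooth_on_def
proof safe
  fix V \<phi> k assume V: "(V, \<phi>) \<in> A"
  then have "Ck_on k (\<phi> ` (U \<inter> V)) (f \<circ> inv_into V \<phi>)" "Ck_on k (\<phi> ` (U \<inter> V)) (h \<circ> inv_into V \<phi>)"
    using assms(3,4) unfolding smooth_fun_def smooth_on_def by blast+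
  then show "Ck_on k (\<phi> ` (U \<inter> V)) ((\<lambda>q. f q + c * h q) \<circ> inv_into V \<phi>)"
    unfolding o_def by (rule Ck_on_add_scaled[OF open_chart_image[OF assms(1) V assms(2)]])
qed

lemma smooth_fun_sum:
  assumes "smooth_atlas A" "open U" "\<And>i. i \<in> I \<Longrightarrow> smooth_fun A U (f i)"
  shows "smooth_fun A U (\<lambda>q. \<Sum>i\<in>I. f i q)"
  using assms(3)
proof (induction I rule: infinite_finite_induct)
  case (insert i I)
  have "smooth_fun A U (\<lambda>q. \<Sum>j\<in>I. f j q)"
    by (rule insert.IH) (rule insert.prems, simp)
  then have "smooth_fun A U (\<lambda>q. f i q + 1 * (\<Sum>j\<in>I. f j q))"
    by (intro smooth_fun_add_scaled[OF assms(1,2)] insert.prems) simp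
  then show ?case by (simp only: sum.insert[OF insert.hyps] mult_1)
qed (simp_all only: sum.infinite sum.empty not_False_eq_True smooth_fun_const)

lemma smooth_near_if_smooth_fun: "smooth_fun A U f \<Longrightarrow> open U \<Longrightarrow> p \<in> U \<Longrightarrow> smooth_near A p f"
  unfolding smooth_near_def by blast


section \<open>Tangent vectors as derivations\<close>

text \<open>A curried form of the definition, from which each derivation rule is one projection.\<close>

lemma tangent_space_iff:
  "v \<in> tangent_space A p \<longleftrightarrow>
    (\<forall>f h. smooth_near A p f \<longrightarrow> smooth_near A p h \<longrightarrow> v (\<lambda>q. f q + h q) = v f + v h) \<and>
    (\<forall>f h. smooth_near A p f \<longrightarrow> smooth_near A p h \<longrightarrow>
      v (\<lambda>q. f q * h q) = v f * h p + f p * v h) \<and>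
    (\<forall>c f. smooth_near A p f \<longrightarrow> v (\<lambda>q. c * f q) = c * v f) \<and>
    (\<forall>f h U. smooth_near A p f \<longrightarrow> open U \<longrightarrow> p \<in> U \<longrightarrow> (\<forall>q\<in>U. f q = h q) \<longrightarrow> v f = v h) \<and>
    (\<forall>f. \<not> smooth_near A p f \<longrightarrow> v f = 0)"
  by (simp only: tangent_space_def mem_Collect_eq imp_conjL imp_conjR all_conj_distrib conj_assoc)

lemmas derivation_add = tangent_space_iff[THEN iffD1, THEN conjunct1, rule_format]
  and derivation_mult = tangent_space_iff[THEN iffD1, THEN conjunct2, THEN conjunct1, rule_format]
  and derivation_cmult = tangent_space_iff[THEN iffD1, THEN conjunct2, THEN conjunct2,
    THEN conjunct1, rule_format]
  and derivation_germ = tangent_space_iff[THEN iffD1, THEN conjunct2, THEN conjunct2,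
    THEN conjunct2, THEN conjunct1, rule_format]
  and derivation_not_smooth = tangent_space_iff[THEN iffD1, THEN conjunct2, THEN conjunct2,
    THEN conjunct2, THEN conjunct2, rule_format]

lemma tangent_spaceI:
  assumes "\<And>f h. smooth_near A p f \<Longrightarrow> smooth_near A p h \<Longrightarrow> v (\<lambda>q. f q + h q) = v f + v h"
    and "\<And>f h. smooth_near A p f \<Longrightarrow> smooth_near A p h \<Longrightarrow>
      v (\<lambda>q. f q * h q) = v f * h p + f p * v h"
    and "\<And>c f. smooth_near A p f \<Longrightarrow> v (\<lambda>q. c * f q) = c * v f"
    and "\<And>f h U. smooth_near A p f \<Longrightarrow> open U \<Longrightarrow> p \<in> U \<Longrightarrow>
      (\<And>q. q \<in> U \<Longrightarrow> f q = h q) \<Longrightarrow> v f = v h"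
    and "\<And>f. \<not> smooth_near A p f \<Longrightarrow> v f = 0"
  shows "v \<in> tangent_space A p"
  unfolding tangent_space_iff by (intro conjI allI impI; (elim bspec)?; rule assms; (elim bspec)?)

lemma tangent_add:
  assumes v: "v \<in> tangent_space A p" and w: "w \<in> tangent_space A p"
  shows "v + w \<in> tangent_space A p"
proof (rule tangent_spaceI)
  fix f h assume s: "smooth_near A p f" "smooth_near A p h"
  show "(v + w) (\<lambda>q. f q + h q) = (v + w) f + (v + w) h"
    unfolding plus_fun_apply derivation_add[OF v s] derivation_add[OF w s] by simp
  show "(v + w) (\<lambda>q. f q * h q) = (v + w) f * h p + f p * (v + w) h"
    unfolding plus_fun_apply derivation_mult[OF v s] derivation_mult[OF w s]
    by (simp add: algebra_simps)
next
  fix c f assume s: "smooth_near A p f"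
  show "(v + w) (\<lambda>q. c * f q) = c * (v + w) f"
    unfolding plus_fun_apply derivation_cmult[OF v s] derivation_cmult[OF w s]
    by (simp add: algebra_simps)
next
  fix f h U assume s: "smooth_near A p f" "open U" "p \<in> U" "\<And>q. q \<in> U \<Longrightarrow> f q = h q"
  show "(v + w) f = (v + w) h"
    unfolding plus_fun_apply using derivation_germ[OF v s] derivation_germ[OF w s] by simp
next
  fix f assume s: "\<not> smooth_near A p f"
  show "(v + w) f = 0"
    using derivation_not_smooth[OF v s] derivation_not_smooth[OF w s] by simp
qed

lemma tangent_scale:
  assumes v: "v \<in> tangent_space A p"
  shows "c *\<^sub>t v \<in> tangent_space A p"
proof (rule tangent_spaceI)
  fix f h assume s: "smooth_near A p f" "smooth_near A p h"
  show "(c *\<^sub>t v) (\<lambda>q. f q + h q) = (c *\<^sub>t v) f + (c *\<^sub>t v) h"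
    unfolding scale_tvec_def derivation_add[OF v s] by (simp add: algebra_simps)
  show "(c *\<^sub>t v) (\<lambda>q. f q * h q) = (c *\<^sub>t v) f * h p + f p * (c *\<^sub>t v) h"
    unfolding scale_tvec_def derivation_mult[OF v s] by (simp add: algebra_simps)
next
  fix b f assume s: "smooth_near A p f"
  show "(c *\<^sub>t v) (\<lambda>q. b * f q) = b * (c *\<^sub>t v) f"
    unfolding scale_tvec_def derivation_cmult[OF v s] by (simp add: algebra_simps)
next
  fix f h U assume s: "smooth_near A p f" "open U" "p \<in> U" "\<And>q. q \<in> U \<Longrightarrow> f q = h q"
  show "(c *\<^sub>t v) f = (c *\<^sub>t v) h"
    unfolding scale_tvec_def using derivation_germ[OF v s] by simp
next
  fix f assume s: "\<not> smooth_near A p f"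
  show "(c *\<^sub>t v) f = 0"
    using derivation_not_smooth[OF v s] by (simp add: scale_tvec_def)
qed

lemma tangent_zero: "0 \<in> tangent_space A p"
  unfolding tangent_space_def by simp

lemma uminus_eq_scale_tvec: "- v = (-1) *\<^sub>t (v :: 'a tvec)"
  by (simp add: scale_tvec_def fun_eq_iff)

lemma diff_eq_add_scale_tvec: "v - w = v + (-1) *\<^sub>t (w :: 'a tvec)"
  by (simp add: scale_tvec_def fun_eq_iff)

lemma tangent_diff:
  "v \<in> tangent_space A p \<Longrightarrow> w \<in> tangent_space A p \<Longrightarrow> v - w \<in> tangent_space A p"
  by (simp add: diff_eq_add_scale_tvec tangent_add tangent_scale)

lemma tangent_sum:
  "(\<And>i. i \<in> I \<Longrightarrow> v i \<in> tangent_space A p) \<Longrightarrow> (\<Sum>i\<in>I. v i) \<in> tangent_space A p"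
  by (induction I rule: infinite_finite_induct) (auto intro: tangent_add tangent_zero)

lemma derivation_local:
  assumes "v \<in> tangent_space A p" "smooth_fun A U f" "open U" "p \<in> U" "\<And>q. q \<in> U \<Longrightarrow> f q = h q"
  shows "v h = v f"
  using derivation_germ[OF assms(1) smooth_near_if_smooth_fun[OF assms(2-4)] assms(3,4,5)] by simp

lemma derivation_const:
  assumes "v \<in> tangent_space A p"
  shows "v (\<lambda>q. c) = 0"
proof -
  have s: "smooth_near A p (\<lambda>q. c)" for c
    using smooth_near_if_smooth_fun[OF smooth_fun_const, of UNIV] by simp
  have "v (\<lambda>q. 1) = 0" using derivation_mult[OF assms s[of 1] s[of 1]] by simp
  then show ?thesis using derivation_cmult[OF assms s[of 1], of c] by simp
qed

lemma derivation_add_scaled: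
  assumes A: "smooth_atlas A" and v: "v \<in> tangent_space A p"
    and fh: "smooth_fun A U f" "smooth_fun A U h" and U: "open U" "p \<in> U"
  shows "v (\<lambda>q. f q + c * h q) = v f + c * v h"
proof -
  have "smooth_fun A U (\<lambda>q. 0 + c * h q)"
    by (rule smooth_fun_add_scaled[OF A U(1) smooth_fun_const fh(2)])
  then have "smooth_near A p (\<lambda>q. c * h q)" using smooth_near_if_smooth_fun[OF _ U] by simp
  note derivation_add[OF v smooth_near_if_smooth_fun[OF fh(1) U] this]
  then show ?thesis using derivation_cmult[OF v smooth_near_if_smooth_fun[OF fh(2) U]] by simp
qed

lemma derivation_sum:
  assumes A: "smooth_atlas A" and v: "v \<in> tangent_space A p"
    and f: "\<And>i. i \<in> I \<Longrightarrow> smooth_fun A U (f i)" and U: "open U" "p \<in> U"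
  shows "v (\<lambda>q. \<Sum>i\<in>I. f i q) = (\<Sum>i\<in>I. v (f i))"
  using f
proof (induction I rule: infinite_finite_induct)
  case (insert i I)
  have "smooth_fun A U (\<lambda>q. \<Sum>j\<in>I. f j q)" "smooth_fun A U (f i)"
    using insert.prems by (auto intro!: smooth_fun_sum[OF A U(1)])
  then have "v (\<lambda>q. f i q + (\<Sum>j\<in>I. f j q)) = v (f i) + v (\<lambda>q. \<Sum>j\<in>I. f j q)"
    using derivation_add[OF v] smooth_near_if_smooth_fun[OF _ U] by blast
  also have "v (\<lambda>q. \<Sum>j\<in>I. f j q) = (\<Sum>j\<in>I. v (f j))"
    by (rule insert.IH) (rule insert.prems, simp)
  finally show ?case by (simp only: sum.insert[OF insert.hyps])
qed (simp_all only: sum.infinite sum.empty not_False_eq_True derivation_const[OF v])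

lemma smooth_vfield_tangent: "smooth_vfield A U X \<Longrightarrow> p \<in> U \<Longrightarrow> X p \<in> tangent_space A p"
  unfolding smooth_vfield_def by blast


section \<open>Algebra of the metric at a point\<close>

lemma
  assumes g: "riemannian_metric A g" and u: "u \<in> tangent_space A p" and v: "v \<in> tangent_space A p"
  shows metric_sym: "g p u v = g p v u"
    and metric_scale_left: "g p (c *\<^sub>t u) v = c * g p u v"
    and metric_add_left: "w \<in> tangent_space A p \<Longrightarrow> g p (u + v) w = g p u w + g p v w"
  using assms unfolding riemannian_metric_def by simp_all

lemma metric_diff_left:
  assumes g: "riemannian_metric A g"
    and t: "u \<in> tangent_space A p" "v \<in> tangent_space A p" "w \<in> tangent_space A p"
  shows "g p (u - v) w = g p u w - g p v w"
  using metric_add_left[OF g t(1) tangent_scale[OF t(2)] t(3), of "-1"]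
    metric_scale_left[OF g t(2,3), of "-1"]
  by (simp only: diff_eq_add_scale_tvec)

lemma metric_uminus_left:
  assumes g: "riemannian_metric A g" and t: "u \<in> tangent_space A p" "v \<in> tangent_space A p"
  shows "g p (- u) v = - g p u v"
  using metric_scale_left[OF g t, of "-1"] by (simp add: uminus_eq_scale_tvec)

lemma metric_uminus_right:
  assumes g: "riemannian_metric A g" and t: "u \<in> tangent_space A p" "v \<in> tangent_space A p"
  shows "g p v (- u) = - g p v u"
  using metric_uminus_left[OF g t] metric_sym[OF g t]
    metric_sym[OF g tangent_scale[OF t(1), of "-1"] t(2)] by (simp add: uminus_eq_scale_tvec)

lemma metric_zero_left:
  assumes g: "riemannian_metric A g" and t: "v \<in> tangent_space A p"
  shows "g p 0 v = 0"
  using metric_diff_left[OF g t t t] by simp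

lemma metric_sum_scaled_left:
  assumes g: "riemannian_metric A g"
    and v: "\<And>i. i \<in> I \<Longrightarrow> v i \<in> tangent_space A p" and w: "w \<in> tangent_space A p"
  shows "g p (\<Sum>i\<in>I. a i *\<^sub>t v i) w = (\<Sum>i\<in>I. a i * g p (v i) w)"
  using v
proof (induction I rule: infinite_finite_induct)
  case (insert i I)
  have t: "(\<Sum>i\<in>I. a i *\<^sub>t v i) \<in> tangent_space A p"
    using insert.prems by (intro tangent_sum tangent_scale) simp
  have i: "v i \<in> tangent_space A p" using insert.prems by simp
  have "g p (\<Sum>i\<in>I. a i *\<^sub>t v i) w = (\<Sum>i\<in>I. a i * g p (v i) w)"
    using insert.prems by (intro insert.IH) simp
  then show ?case
    by (simp only: sum.insert[OF insert.hyps] metric_add_left[OF g tangent_scale[OF i] t w]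
        metric_scale_left[OF g i w])
qed (simp_all add: metric_zero_left[OF g w])

lemma smooth_metric:
  assumes "riemannian_metric A g" "open U" "smooth_vfield A U X" "smooth_vfield A U Y"
  shows "smooth_fun A U (\<lambda>q. g q (X q) (Y q))"
  using assms unfolding riemannian_metric_def apply_metric_def by blast


section \<open>Connections\<close>

lemma
  assumes "connection A D" "open U" "smooth_vfield A U Y"
  shows smooth_cov_deriv: "smooth_vfield A U X \<Longrightarrow> smooth_vfield A U (cov_deriv D X Y)"
    and conn_tangent: "p \<in> U \<Longrightarrow> v \<in> tangent_space A p \<Longrightarrow> D p v Y \<in> tangent_space A p"
    and conn_add: "p \<in> U \<Longrightarrow> v \<in> tangent_space A p \<Longrightarrow> w \<in> tangent_space A p \<Longrightarrow>
      D p (v + w) Y = D p v Y + D p w Y"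
    and conn_scale: "p \<in> U \<Longrightarrow> v \<in> tangent_space A p \<Longrightarrow> D p (c *\<^sub>t v) Y = c *\<^sub>t D p v Y"
    and conn_local: "p \<in> U \<Longrightarrow> v \<in> tangent_space A p \<Longrightarrow> smooth_vfield A U Z \<Longrightarrow>
      (\<And>q. q \<in> U \<Longrightarrow> Y q = Z q) \<Longrightarrow> D p v Y = D p v Z"
    and conn_leibniz: "p \<in> U \<Longrightarrow> v \<in> tangent_space A p \<Longrightarrow> smooth_fun A U f \<Longrightarrow>
      D p v (\<lambda>q. f q *\<^sub>t Y q) = v f *\<^sub>t Y p + f p *\<^sub>t D p v Y"
  using assms unfolding connection_def by simp_all

lemma conn_sum_scaled:
  assumes D: "connection A D" and U: "open U" "p \<in> U" and Y: "smooth_vfield A U Y"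
    and v: "\<And>i. i \<in> I \<Longrightarrow> v i \<in> tangent_space A p"
  shows "D p (\<Sum>i\<in>I. a i *\<^sub>t v i) Y = (\<Sum>i\<in>I. a i *\<^sub>t D p (v i) Y)"
  using v
proof (induction I rule: infinite_finite_induct)
  case (insert i I)
  have t: "(\<Sum>i\<in>I. a i *\<^sub>t v i) \<in> tangent_space A p"
    using insert.prems by (intro tangent_sum tangent_scale) simp
  have i: "v i \<in> tangent_space A p" using insert.prems by simp
  have "D p (\<Sum>i\<in>I. a i *\<^sub>t v i) Y = (\<Sum>i\<in>I. a i *\<^sub>t D p (v i) Y)"
    using insert.prems by (intro insert.IH) simp
  then show ?case
    by (simp only: sum.insert[OF insert.hyps] conn_add[OF D U(1) Y U(2) tangent_scale[OF i] t]
        conn_scale[OF D U(1) Y U(2) i])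
next
  case (infinite I)
  show ?case using conn_scale[OF D U(1) Y U(2) tangent_zero, of 0] infinite.hyps
    by (simp add: scale_tvec_def zero_fun_def)
next
  case empty
  show ?case using conn_scale[OF D U(1) Y U(2) tangent_zero, of 0]
    by (simp add: scale_tvec_def zero_fun_def)
qed

lemma metric_connection_product:
  assumes "metric_connection A g D" "open U" "p \<in> U"
    and "smooth_vfield A U X" "smooth_vfield A U Y" "smooth_vfield A U Z"
  shows "X p (\<lambda>q. g q (Y q) (Z q)) = g p (D p (X p) Y) (Z p) + g p (Y p) (D p (X p) Z)"
  using assms unfolding metric_connection_def apply_metric_def cov_deriv_def by blast

lemma metric_connection_imp_connection: "metric_connection A g D \<Longrightarrow> connection A D"
  unfolding metric_connection_def by blast

text \<open>The Levi-Civita connection replaces the Lie bracket throughout: it shows that the bracket is a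
  tangent vector and gives its components in a frame.\<close>

lemma lie_bracket_eq_levi_civita:
  assumes "levi_civita_connection A g LC" "open U" "p \<in> U" "smooth_vfield A U X" "smooth_vfield A U Y"
  shows "lie_bracket A X Y p = LC p (X p) Y - LC p (Y p) X"
proof -
  have "torsion A LC X Y p = 0"
    using assms unfolding levi_civita_connection_def by blast
  then show ?thesis unfolding torsion_def cov_deriv_def by simp
qed

text \<open>The torsion is \<open>a\<^sub>X Y - a\<^sub>Y X\<close> for the difference tensor \<open>a = D - LC\<close>.\<close>

lemma torsion_eq_difference:
  assumes "levi_civita_connection A g LC" "open U" "p \<in> U" "smooth_vfield A U X" "smooth_vfield A U Y"
  shows "torsion A D X Y p = (D p (X p) Y - D p (Y p) X) - (LC p (X p) Y - LC p (Y p) X)"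
  using lie_bracket_eq_levi_civita[OF assms] by (simp add: torsion_def cov_deriv_def)

lemma levi_civita_imp_metric: "levi_civita_connection A g LC \<Longrightarrow> metric_connection A g LC"
  unfolding levi_civita_connection_def by blast

lemma conn_uminus_direction:
  assumes "connection A D" "open U" "p \<in> U" "smooth_vfield A U Y" "v \<in> tangent_space A p"
  shows "D p (- v) Y = - D p v Y"
  using conn_scale[OF assms(1,2,4,3,5), of "-1"] by (simp only: uminus_eq_scale_tvec)

lemma conn_uminus_field:
  assumes A: "smooth_atlas A" and D: "connection A D" and U: "open U" "p \<in> U"
    and Y: "smooth_vfield A U Y" and Z: "smooth_vfield A U Z"
    and v: "v \<in> tangent_space A p" and eq: "\<And>q. q \<in> U \<Longrightarrow> Z q = - Y q"
  shows "D p v Z = - D p v Y"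
proof -
  have "D p v Z = D p v (\<lambda>q. (-1) *\<^sub>t Y q)"
  proof (rule conn_local[OF D U(1) Z U(2) v])
    show "smooth_vfield A U (\<lambda>q. (-1) *\<^sub>t Y q)"
      unfolding smooth_vfield_def
    proof safe
      fix q assume "q \<in> U"
      then show "(-1) *\<^sub>t Y q \<in> tangent_space A q"
        by (intro tangent_scale smooth_vfield_tangent[OF Y])
    next
      fix V f assume V: "open V" "V \<subseteq> U" "smooth_fun A V f"
      then have "smooth_fun A V (\<lambda>q. Y q f)" using Y unfolding smooth_vfield_def by blast
      then have "smooth_fun A V (\<lambda>q. 0 + (-1) * Y q f)"
        by (rule smooth_fun_add_scaled[OF A V(1) smooth_fun_const])
      then show "smooth_fun A V (\<lambda>q. ((-1) *\<^sub>t Y q) f)" by (simp add: scale_tvec_def)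
    qed
  qed (simp add: eq uminus_eq_scale_tvec)
  also have "\<dots> = - D p v Y"
    using conn_leibniz[OF D U(1) Y U(2) v smooth_fun_const, of "-1"] derivation_const[OF v, of "-1"]
    by (simp add: scale_tvec_def fun_eq_iff)
  finally show ?thesis .
qed


section \<open>Quadratic identities for contorsion tensors\<close>

lemma sum3_swap12:
  fixes f :: "'i \<Rightarrow> 'i \<Rightarrow> 'i \<Rightarrow> real"
  shows "(\<Sum>i\<in>I. \<Sum>j\<in>I. \<Sum>k\<in>I. f j i k) = (\<Sum>i\<in>I. \<Sum>j\<in>I. \<Sum>k\<in>I. f i j k)"
  by (rule sum.swap)

lemma sum3_swap23:
  fixes f :: "'i \<Rightarrow> 'i \<Rightarrow> 'i \<Rightarrow> real"
  shows "(\<Sum>i\<in>I. \<Sum>j\<in>I. \<Sum>k\<in>I. f i k j) = (\<Sum>i\<in>I. \<Sum>j\<in>I. \<Sum>k\<in>I. f i j k)"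
  by (rule sum.cong[OF refl], rule sum.swap)

lemma sum3_rotate:
  fixes f :: "'i \<Rightarrow> 'i \<Rightarrow> 'i \<Rightarrow> real"
  shows "(\<Sum>i\<in>I. \<Sum>j\<in>I. \<Sum>k\<in>I. f j k i) = (\<Sum>i\<in>I. \<Sum>j\<in>I. \<Sum>k\<in>I. f i j k)"
  using sum3_swap12[of "\<lambda>i j k. f i k j" I] sum3_swap23[of f I] by simp

text \<open>Let \<open>Q = \<Sum> T\<^sub>i\<^sub>j\<^sub>k\<^sup>2\<close>, \<open>P = \<Sum> T\<^sub>i\<^sub>j\<^sub>k T\<^sub>j\<^sub>k\<^sub>i\<close>, \<open>H = \<Sum> a\<^sub>i\<^sub>j\<^sub>k\<^sup>2\<close> and \<open>X = \<Sum> a\<^sub>i\<^sub>j\<^sub>k a\<^sub>j\<^sub>i\<^sub>k\<close>. Skewness and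
  relabelling of the indices give \<open>Q = 2H - 2X\<close> and \<open>P = H - 3X\<close>, while the square of the cyclic sum
  of \<open>T\<close> adds up to \<open>3Q + 6P\<close>. So the left-hand side is \<open>Q/4 - P/2 = X\<close>. It is
  \<open>|T|\<^sup>2 - 9/2 |t|\<^sup>2\<close> when \<open>T\<close> is the torsion of a metric connection with difference tensor \<open>a\<close>.\<close>

lemma contorsion_quadratic:
  fixes a T :: "'i \<Rightarrow> 'i \<Rightarrow> 'i \<Rightarrow> real"
  assumes skew: "\<And>i j k. i \<in> I \<Longrightarrow> j \<in> I \<Longrightarrow> k \<in> I \<Longrightarrow> a i j k = - a i k j"
    and T: "\<And>i j k. i \<in> I \<Longrightarrow> j \<in> I \<Longrightarrow> k \<in> I \<Longrightarrow> T i j k = a i j k - a j i k"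
  shows "1/2 * (\<Sum>i\<in>I. \<Sum>j\<in>I. \<Sum>k\<in>I. (T i j k)\<^sup>2)
      - 1/12 * (\<Sum>i\<in>I. \<Sum>j\<in>I. \<Sum>k\<in>I. (T j k i + T i j k + T k i j)\<^sup>2)
    = (\<Sum>i\<in>I. \<Sum>j\<in>I. \<Sum>k\<in>I. a i j k * a j i k)"
proof -
  define f where "f i j k = a i j k * a j i k" for i j k
  define h where "h i j k = (a i j k)\<^sup>2" for i j k
  define Tt where "Tt i j k = T i j k * T j k i" for i j k
  have "(T i j k)\<^sup>2 = h i j k + h j i k - 2 * f i j k" if "i \<in> I" "j \<in> I" "k \<in> I" for i j k
    using that by (simp add: T f_def h_def power2_eq_square algebra_simps)
  then have Q: "(\<Sum>i\<in>I. \<Sum>j\<in>I. \<Sum>k\<in>I. (T i j k)\<^sup>2) =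
      2 * (\<Sum>i\<in>I. \<Sum>j\<in>I. \<Sum>k\<in>I. h i j k) - 2 * (\<Sum>i\<in>I. \<Sum>j\<in>I. \<Sum>k\<in>I. f i j k)"
    using sum3_swap12[of h I]
    by (simp add: sum.distrib sum_subtractf sum_distrib_left[symmetric] cong: sum.cong)
  have "Tt i j k = h j i k - f i j k - f i k j - f j k i"
    if I: "i \<in> I" "j \<in> I" "k \<in> I" for i j k
    using skew[of i j k] skew[of j i k] skew[of k i j] I
    by (simp add: T Tt_def f_def h_def power2_eq_square algebra_simps)
  then have P: "(\<Sum>i\<in>I. \<Sum>j\<in>I. \<Sum>k\<in>I. Tt i j k) =
      (\<Sum>i\<in>I. \<Sum>j\<in>I. \<Sum>k\<in>I. h i j k) - 3 * (\<Sum>i\<in>I. \<Sum>j\<in>I. \<Sum>k\<in>I. f i j k)"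
    using sum3_swap12[of h I] sum3_swap23[of f I] sum3_rotate[of f I]
    by (simp add: sum.distrib sum_subtractf cong: sum.cong)
  have "(T j k i + T i j k + T k i j)\<^sup>2 =
      (T i j k)\<^sup>2 + (T j k i)\<^sup>2 + (T k i j)\<^sup>2 + 2 * Tt i j k + 2 * Tt j k i + 2 * Tt k i j" for i j k
    by (simp add: Tt_def power2_eq_square algebra_simps)
  then have "(\<Sum>i\<in>I. \<Sum>j\<in>I. \<Sum>k\<in>I. (T j k i + T i j k + T k i j)\<^sup>2) =
      3 * (\<Sum>i\<in>I. \<Sum>j\<in>I. \<Sum>k\<in>I. (T i j k)\<^sup>2) + 6 * (\<Sum>i\<in>I. \<Sum>j\<in>I. \<Sum>k\<in>I. Tt i j k)"
    using sum3_rotate[of "\<lambda>i j k. (T i j k)\<^sup>2" I] sum3_rotate[of "\<lambda>i j k. (T j k i)\<^sup>2" I]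
      sum3_rotate[of Tt I] sum3_rotate[of "\<lambda>i j k. Tt j k i" I]
    by (simp add: sum.distrib sum_distrib_left[symmetric])
  with Q P show ?thesis unfolding f_def by linarith
qed

text \<open>The quadratic part of the scalar curvature of \<open>C\<close> minus that of \<open>L\<close>, apart from squares of
  traces. With \<open>C = L + a\<close> the terms linear in \<open>a\<close> are four relabellings of \<open>L\<^sub>i\<^sub>j\<^sub>k a\<^sub>j\<^sub>i\<^sub>k\<close>, two with each
  sign, so they cancel in the sum.\<close>

lemma connection_coefficients_quadratic:
  fixes C L :: "'i \<Rightarrow> 'i \<Rightarrow> 'i \<Rightarrow> real"
  assumes C: "\<And>i j k. i \<in> I \<Longrightarrow> j \<in> I \<Longrightarrow> k \<in> I \<Longrightarrow> C i j k = - C i k j"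
    and L: "\<And>i j k. i \<in> I \<Longrightarrow> j \<in> I \<Longrightarrow> k \<in> I \<Longrightarrow> L i j k = - L i k j"
  shows "((\<Sum>i\<in>I. \<Sum>j\<in>I. \<Sum>k\<in>I. C i j k * C j i k)
        - (\<Sum>i\<in>I. \<Sum>j\<in>I. \<Sum>k\<in>I. (L i j k - L j i k) * C k j i))
      - ((\<Sum>i\<in>I. \<Sum>j\<in>I. \<Sum>k\<in>I. L i j k * L j i k)
        - (\<Sum>i\<in>I. \<Sum>j\<in>I. \<Sum>k\<in>I. (L i j k - L j i k) * L k j i))
    = (\<Sum>i\<in>I. \<Sum>j\<in>I. \<Sum>k\<in>I. (C i j k - L i j k) * (C j i k - L j i k))"
proof -
  define f where "f i j k = L i j k * (C j i k - L j i k)" for i j k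
  have "(C i j k * C j i k - (L i j k - L j i k) * C k j i)
      - (L i j k * L j i k - (L i j k - L j i k) * L k j i)
      = (C i j k - L i j k) * (C j i k - L j i k) + (f i j k + f j i k - f i k j - f j k i)"
    if I: "i \<in> I" "j \<in> I" "k \<in> I" for i j k
    using C[of k i j] L[of i j k] L[of j i k] L[of k i j] I
    by (simp add: f_def algebra_simps)
  then have "(\<Sum>i\<in>I. \<Sum>j\<in>I. \<Sum>k\<in>I. (C i j k * C j i k - (L i j k - L j i k) * C k j i)
      - (L i j k * L j i k - (L i j k - L j i k) * L k j i))
    = (\<Sum>i\<in>I. \<Sum>j\<in>I. \<Sum>k\<in>I. (C i j k - L i j k) * (C j i k - L j i k)
        + (f i j k + f j i k - f i k j - f j k i))"
    by (intro sum.cong refl) simp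
  then show ?thesis
    unfolding sum.distrib sum_subtractf
    using sum3_swap12[of f I] sum3_swap23[of f I] sum3_rotate[of f I] by linarith
qed


section \<open>Metric connections in an orthonormal frame\<close>

locale orthonormal_frame =
  fixes A :: "('a::{t2_space,second_countable_topology}, 'e::euclidean_space) chart set"
    and g :: "'a \<Rightarrow> 'a tvec \<Rightarrow> 'a tvec \<Rightarrow> real" and n :: nat
    and U :: "'a set" and e :: "nat \<Rightarrow> 'a vfield"
  assumes atlas: "smooth_atlas A" and metric: "riemannian_metric A g" and open_U: "open U"
    and smooth_frame: "i \<in> {1..2*n} \<Longrightarrow> smooth_vfield A U (e i)"
    and orthonormal: "p \<in> U \<Longrightarrow> i \<in> {1..2*n} \<Longrightarrow> j \<in> {1..2*n} \<Longrightarrow>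
      g p (e i p) (e j p) = (if i = j then 1 else 0)"
    and spanning: "p \<in> U \<Longrightarrow> v \<in> tangent_space A p \<Longrightarrow> \<exists>a. v = (\<Sum>i=1..2*n. a i *\<^sub>t e i p)"
begin

abbreviation I :: "nat set" where "I \<equiv> {1..2*n}"

definition christoffel :: "'a conn \<Rightarrow> nat \<Rightarrow> nat \<Rightarrow> nat \<Rightarrow> 'a \<Rightarrow> real" where
  "christoffel D i j k p = g p (D p (e i p) (e j)) (e k p)"

lemma frame_tangent: "i \<in> I \<Longrightarrow> p \<in> U \<Longrightarrow> e i p \<in> tangent_space A p"
  using smooth_frame smooth_vfield_tangent by blast

lemma frame_expansion:
  assumes p: "p \<in> U" and v: "v \<in> tangent_space A p"
  shows "v = (\<Sum>i\<in>I. g p v (e i p) *\<^sub>t e i p)"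
proof -
  obtain a where a: "v = (\<Sum>i\<in>I. a i *\<^sub>t e i p)" using spanning[OF p v] by blast
  have "g p v (e j p) = a j" if j: "j \<in> I" for j
  proof -
    have "g p v (e j p) = (\<Sum>i\<in>I. a i * g p (e i p) (e j p))"
      unfolding a by (rule metric_sum_scaled_left[OF metric frame_tangent[OF _ p] frame_tangent[OF j p]])
    also have "\<dots> = (\<Sum>i\<in>I. if i = j then a i else 0)"
      by (rule sum.cong) (simp_all add: orthonormal[OF p _ j])
    finally show ?thesis using j by (simp add: sum.delta)
  qed
  then have "(\<Sum>i\<in>I. g p v (e i p) *\<^sub>t e i p) = (\<Sum>i\<in>I. a i *\<^sub>t e i p)"
    by (intro sum.cong) simp_all
  then show ?thesis using a by simp
qed

lemma metric_frame_expansion: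
  assumes p: "p \<in> U" and v: "v \<in> tangent_space A p" and w: "w \<in> tangent_space A p"
  shows "g p v w = (\<Sum>k\<in>I. g p v (e k p) * g p w (e k p))"
proof -
  have "g p v w = g p (\<Sum>k\<in>I. g p v (e k p) *\<^sub>t e k p) w"
    using frame_expansion[OF p v] by simp
  also have "\<dots> = (\<Sum>k\<in>I. g p v (e k p) * g p (e k p) w)"
    by (rule metric_sum_scaled_left[OF metric frame_tangent[OF _ p] w])
  also have "\<dots> = (\<Sum>k\<in>I. g p v (e k p) * g p w (e k p))"
    by (intro sum.cong refl arg_cong2[of _ _ _ _ "(*)"]) (rule metric_sym[OF metric frame_tangent[OF _ p] w])
  finally show ?thesis .
qed

lemma conn_frame_expansion:
  assumes D: "connection A D" and p: "p \<in> U" and v: "v \<in> tangent_space A p"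
    and w: "w \<in> tangent_space A p" and Y: "smooth_vfield A U Y"
  shows "g p (D p v Y) w = (\<Sum>k\<in>I. g p v (e k p) * g p (D p (e k p) Y) w)"
proof -
  have "D p v Y = (\<Sum>k\<in>I. g p v (e k p) *\<^sub>t D p (e k p) Y)"
    using conn_sum_scaled[OF D open_U p Y frame_tangent[OF _ p], of I "\<lambda>k. k" "\<lambda>k. g p v (e k p)"]
      frame_expansion[OF p v] by simp
  then show ?thesis
    using metric_sum_scaled_left[OF metric conn_tangent[OF D open_U Y p frame_tangent[OF _ p]] w,
        of I "\<lambda>k. k" "\<lambda>k. g p v (e k p)"] by simp
qed

lemma christoffel_smooth:
  assumes "connection A D" "i \<in> I" "j \<in> I" "k \<in> I"
  shows "smooth_fun A U (christoffel D i j k)"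
proof -
  have "smooth_fun A U (\<lambda>p. g p (cov_deriv D (e i) (e j) p) (e k p))"
    by (intro smooth_metric[OF metric open_U] smooth_cov_deriv[OF assms(1) open_U] smooth_frame assms)
  then show ?thesis unfolding cov_deriv_def christoffel_def[abs_def] by simp
qed

text \<open>The functions \<open>g(e\<^sub>j, e\<^sub>k)\<close> are constant on \<open>U\<close>, and a metric connection differentiates them by
  the product rule.\<close>

lemma christoffel_skew:
  assumes D: "metric_connection A g D" and p: "p \<in> U" and I: "i \<in> I" "j \<in> I" "k \<in> I"
  shows "christoffel D i j k p = - christoffel D i k j p"
proof -
  have "e i p (\<lambda>q. g q (e j q) (e k q)) = e i p (\<lambda>q. if j = k then 1 else 0)"
    by (rule derivation_local[OF frame_tangent[OF I(1) p] smooth_fun_const open_U p])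
      (simp add: orthonormal[OF _ I(2,3)])
  then have "e i p (\<lambda>q. g q (e j q) (e k q)) = 0"
    using derivation_const[OF frame_tangent[OF I(1) p]] by simp
  moreover have "g p (e j p) (D p (e i p) (e k)) = g p (D p (e i p) (e k)) (e j p)"
    by (intro metric_sym[OF metric] frame_tangent I p smooth_frame
        conn_tangent[OF metric_connection_imp_connection[OF D] open_U])
  ultimately show ?thesis
    using metric_connection_product[OF D open_U p smooth_frame[OF I(1)] smooth_frame[OF I(2)]
        smooth_frame[OF I(3)]]
    by (simp add: christoffel_def)
qed

lemma frame_derivative_product:
  assumes D: "metric_connection A g D" and p: "p \<in> U" and I: "i \<in> I" "k \<in> I"
    and Y: "smooth_vfield A U Y"
  shows "g p (D p (e i p) Y) (e k p) = e i p (\<lambda>q. g q (Y q) (e k q)) - g p (Y p) (D p (e i p) (e k))"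
  using metric_connection_product[OF D open_U p smooth_frame[OF I(1)] Y smooth_frame[OF I(2)]]
  by simp

text \<open>Second covariant derivatives are turned into derivatives of the coefficient functions by \<open>Dg = 0\<close>,
  so that covariant derivatives of sums over the frame never have to be expanded. Skewness changes
  \<open>- e\<^sub>j(C\<^sub>i\<^sub>j\<^sub>i)\<close> into \<open>e\<^sub>j(C\<^sub>i\<^sub>i\<^sub>j)\<close>, the mirror image of the other derivative term; this produces the
  factor 2 in front of the codifferential.\<close>

lemma curvature_frame:
  assumes D: "metric_connection A g D" and LC: "levi_civita_connection A g LC"
    and p: "p \<in> U" and I: "i \<in> I" "j \<in> I"
  shows "apply_metric g (curvature A D (e i) (e j) (e j)) (e i) p =
    e i p (christoffel D j j i) + e j p (christoffel D i i j)
    - (\<Sum>k\<in>I. christoffel D j j k p * christoffel D i i k p)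
    + (\<Sum>k\<in>I. christoffel D i j k p * christoffel D j i k p)
    - (\<Sum>k\<in>I. (christoffel LC i j k p - christoffel LC j i k p) * christoffel D k j i p)"
proof -
  note D' = metric_connection_imp_connection[OF D]
  have LC': "connection A LC" using LC unfolding levi_civita_connection_def metric_connection_def by blast
  note e = smooth_frame[OF I(1)] smooth_frame[OF I(2)]
  note t = frame_tangent[OF I(1) p] frame_tangent[OF I(2) p]
  let ?B = "lie_bracket A (e i) (e j) p"
  have B: "?B = LC p (e i p) (e j) - LC p (e j p) (e i)"
    by (rule lie_bracket_eq_levi_civita[OF LC open_U p e])
  have LCt: "LC p (e i p) (e j) \<in> tangent_space A p" "LC p (e j p) (e i) \<in> tangent_space A p"
    using conn_tangent[OF LC' open_U _ p] e t by blast+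
  then have Bt: "?B \<in> tangent_space A p" unfolding B by (rule tangent_diff)
  have Bk: "g p ?B (e k p) = christoffel LC i j k p - christoffel LC j i k p" if "k \<in> I" for k
    unfolding B christoffel_def by (rule metric_diff_left[OF metric LCt frame_tangent[OF that p]])
  have Dt: "D p (e a p) Y \<in> tangent_space A p" if "a \<in> I" "smooth_vfield A U Y" for a Y
    by (rule conn_tangent[OF D' open_U that(2) p frame_tangent[OF that(1) p]])
  have s: "smooth_vfield A U (cov_deriv D (e j) (e j))" "smooth_vfield A U (cov_deriv D (e i) (e j))"
    using smooth_cov_deriv[OF D' open_U] e by blast+
  have BD: "D p ?B (e j) \<in> tangent_space A p"
    by (rule conn_tangent[OF D' open_U e(2) p Bt])
  have sk: "e j p (christoffel D i j i) = - e j p (christoffel D i i j)"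
  proof -
    note c = christoffel_smooth[OF D' I(1) I(1) I(2)] christoffel_smooth[OF D' I(1) I(2) I(1)]
    have "e j p (\<lambda>q. (-1) * christoffel D i i j q) = e j p (christoffel D i j i)"
    proof (rule derivation_local[OF t(2) c(2) open_U p])
      fix q assume "q \<in> U"
      then show "christoffel D i j i q = (-1) * christoffel D i i j q"
        using christoffel_skew[OF D _ I(1) I(2) I(1), of q] by simp
    qed
    then show ?thesis
      using derivation_cmult[OF t(2) smooth_near_if_smooth_fun[OF c(1) open_U p], of "-1"] by simp
  qed
  have R: "apply_metric g (curvature A D (e i) (e j) (e j)) (e i) p =
      g p (D p (e i p) (cov_deriv D (e j) (e j))) (e i p)
      - g p (D p (e j p) (cov_deriv D (e i) (e j))) (e i p) - g p (D p ?B (e j)) (e i p)"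
    unfolding metric_diff_left[OF metric Dt[OF I(1) s(1)] Dt[OF I(2) s(2)] t(1), symmetric]
      metric_diff_left[OF metric tangent_diff[OF Dt[OF I(1) s(1)] Dt[OF I(2) s(2)]] BD t(1), symmetric]
    unfolding apply_metric_def curvature_def cov_deriv_def by simp
  have "g p (D p (e i p) (cov_deriv D (e j) (e j))) (e i p) = e i p (christoffel D j j i)
      - (\<Sum>k\<in>I. christoffel D j j k p * christoffel D i i k p)"
    unfolding frame_derivative_product[OF D p I(1) I(1) s(1)]
    using metric_frame_expansion[OF p Dt[OF I(2) e(2)] Dt[OF I(1) e(1)]]
    by (simp add: cov_deriv_def christoffel_def[abs_def])
  moreover have "g p (D p (e j p) (cov_deriv D (e i) (e j))) (e i p) = e j p (christoffel D i j i)
      - (\<Sum>k\<in>I. christoffel D i j k p * christoffel D j i k p)"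
    unfolding frame_derivative_product[OF D p I(2) I(1) s(2)]
    using metric_frame_expansion[OF p Dt[OF I(1) e(2)] Dt[OF I(2) e(1)]]
    by (simp add: cov_deriv_def christoffel_def[abs_def])
  moreover have "g p (D p ?B (e j)) (e i p) =
      (\<Sum>k\<in>I. (christoffel LC i j k p - christoffel LC j i k p) * christoffel D k j i p)"
    unfolding conn_frame_expansion[OF D' p Bt t(1) e(2)]
    by (intro sum.cong refl) (simp add: Bk christoffel_def)
  ultimately show ?thesis using R sk by linarith
qed

text \<open>The last sum comes from the derivative along \<open>[e\<^sub>i, e\<^sub>j]\<close>; it mixes the two connections because the
  components of the bracket are coefficients of the torsion-free one. The two kinds of derivative
  terms have the same sum, by exchanging \<open>i\<close> and \<open>j\<close>.\<close>

lemma scalar_curvature_frame: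
  assumes D: "metric_connection A g D" and LC: "levi_civita_connection A g LC" and p: "p \<in> U"
  shows "(\<Sum>i\<in>I. \<Sum>j\<in>I. apply_metric g (curvature A D (e i) (e j) (e j)) (e i) p) =
    2 * (\<Sum>i\<in>I. \<Sum>j\<in>I. e i p (christoffel D j j i))
    - (\<Sum>k\<in>I. (\<Sum>i\<in>I. christoffel D i i k p)\<^sup>2)
    + (\<Sum>i\<in>I. \<Sum>j\<in>I. \<Sum>k\<in>I. christoffel D i j k p * christoffel D j i k p)
    - (\<Sum>i\<in>I. \<Sum>j\<in>I. \<Sum>k\<in>I.
        (christoffel LC i j k p - christoffel LC j i k p) * christoffel D k j i p)"
proof -
  have "(\<Sum>k\<in>I. (\<Sum>i\<in>I. christoffel D i i k p)\<^sup>2) =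
      (\<Sum>k\<in>I. \<Sum>i\<in>I. \<Sum>j\<in>I. christoffel D j j k p * christoffel D i i k p)"
    by (simp add: power2_eq_square sum_product mult.commute)
  also have "\<dots> = (\<Sum>i\<in>I. \<Sum>j\<in>I. \<Sum>k\<in>I. christoffel D j j k p * christoffel D i i k p)"
    by (rule sum3_rotate[of "\<lambda>i j k. christoffel D j j k p * christoffel D i i k p"])
  finally have sq: "(\<Sum>k\<in>I. (\<Sum>i\<in>I. christoffel D i i k p)\<^sup>2) =
    (\<Sum>i\<in>I. \<Sum>j\<in>I. \<Sum>k\<in>I. christoffel D j j k p * christoffel D i i k p)" .
  have sw: "(\<Sum>i\<in>I. \<Sum>j\<in>I. e j p (christoffel D i i j)) =
      (\<Sum>i\<in>I. \<Sum>j\<in>I. e i p (christoffel D j j i))"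
    by (rule sum.swap)
  have "(\<Sum>i\<in>I. \<Sum>j\<in>I. apply_metric g (curvature A D (e i) (e j) (e j)) (e i) p) =
    (\<Sum>i\<in>I. \<Sum>j\<in>I. e i p (christoffel D j j i) + e j p (christoffel D i i j)
    - (\<Sum>k\<in>I. christoffel D j j k p * christoffel D i i k p)
    + (\<Sum>k\<in>I. christoffel D i j k p * christoffel D j i k p)
    - (\<Sum>k\<in>I. (christoffel LC i j k p - christoffel LC j i k p) * christoffel D k j i p))"
    by (intro sum.cong refl curvature_frame[OF D LC p])
  then show ?thesis unfolding sum.distrib sum_subtractf sq sw by simp
qed

lemma torsion_frame:
  assumes D: "metric_connection A g D" and LC: "levi_civita_connection A g LC" and p: "p \<in> U"
    and I: "i \<in> I" "j \<in> I"
  shows "torsion A D (e i) (e j) p \<in> tangent_space A p"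
    and "k \<in> I \<Longrightarrow> g p (torsion A D (e i) (e j) p) (e k p) =
      (christoffel D i j k p - christoffel LC i j k p)
      - (christoffel D j i k p - christoffel LC j i k p)"
proof -
  note D' = metric_connection_imp_connection[OF D]
  have LC': "connection A LC" using LC unfolding levi_civita_connection_def metric_connection_def by blast
  note e = smooth_frame[OF I(1)] smooth_frame[OF I(2)]
  have t: "C p (e a p) Y \<in> tangent_space A p" if "connection A C" "a \<in> I" "smooth_vfield A U Y" for a Y C
    by (rule conn_tangent[OF that(1) open_U that(3) p frame_tangent[OF that(2) p]])
  note t1 = t[OF D' I(1) e(2)] and t2 = t[OF D' I(2) e(1)]
    and t3 = t[OF LC' I(1) e(2)] and t4 = t[OF LC' I(2) e(1)]
  have T: "torsion A D (e i) (e j) p = (D p (e i p) (e j) - D p (e j p) (e i))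
      - (LC p (e i p) (e j) - LC p (e j p) (e i))"
    by (rule torsion_eq_difference[OF LC open_U p e])
  show "torsion A D (e i) (e j) p \<in> tangent_space A p"
    unfolding T by (intro tangent_diff t1 t2 t3 t4)
  assume "k \<in> I"
  note k = frame_tangent[OF this p]
  show "g p (torsion A D (e i) (e j) p) (e k p) =
      (christoffel D i j k p - christoffel LC i j k p)
      - (christoffel D j i k p - christoffel LC j i k p)"
    unfolding T christoffel_def metric_diff_left[OF metric tangent_diff[OF t1 t2] tangent_diff[OF t3 t4] k]
      metric_diff_left[OF metric t1 t2 k] metric_diff_left[OF metric t3 t4 k] by simp
qed

text \<open>The identity holds for every metric connection if \<open>\<theta>\<close> is the trace of its torsion. The
  hypothesis states this as \<open>\<theta> = \<Sum>\<^sub>j g(a\<^bsub>e j\<^esub> e j, \<cdot>)\<close> with \<open>a = D - LC\<close>; in this form \<open>X\<close> occurs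
  undifferentiated, so \<open>\<theta>\<close> is visibly tensorial and can be evaluated on \<open>LC\<^bsub>e i\<^esub> e i\<close>, as the
  codifferential requires.\<close>

theorem scalar_curvature_metric_connection:
  fixes \<theta> :: "'a vfield \<Rightarrow> 'a \<Rightarrow> real"
  assumes D: "metric_connection A g D" and LC: "levi_civita_connection A g LC" and p: "p \<in> U"
    and \<theta>: "\<And>X q. smooth_vfield A U X \<Longrightarrow> q \<in> U \<Longrightarrow>
      \<theta> X q = (\<Sum>j\<in>I. g q (D q (e j q) (e j)) (X q) - g q (LC q (e j q) (e j)) (X q))"
  shows "2 * third_scalar A g n e D p - riemannian_scalar A g n e LC p =
    torsion_norm2 A g n e D p - 9/2 * norm2_3form n e (torsion_antisym A g D) p
    - 2 * codifferential n e LC \<theta> p - norm2_1form n e \<theta> p"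
proof -
  note D' = metric_connection_imp_connection[OF D]
  have LCm: "metric_connection A g LC" using LC unfolding levi_civita_connection_def by blast
  note LC' = metric_connection_imp_connection[OF LCm]
  define C where "C i j k = christoffel D i j k p" for i j k
  define L where "L i j k = christoffel LC i j k p" for i j k
  define a where "a i j k = C i j k - L i j k" for i j k
  define T where "T i j k = g p (torsion A D (e i) (e j) p) (e k p)" for i j k
  have Tt: "torsion A D (e i) (e j) p \<in> tangent_space A p" if "i \<in> I" "j \<in> I" for i j
    using torsion_frame(1)[OF D LC p] that by blast
  have T: "T i j k = a i j k - a j i k" if "i \<in> I" "j \<in> I" "k \<in> I" for i j k
    using torsion_frame(2)[OF D LC p that] by (simp add: T_def a_def C_def L_def)
  have Cs: "C i j k = - C i k j" and Ls: "L i j k = - L i k j"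
    if "i \<in> I" "j \<in> I" "k \<in> I" for i j k
    using christoffel_skew[OF D p that] christoffel_skew[OF LCm p that]
    by (simp_all add: C_def L_def)
  have as: "a i j k = - a i k j" if "i \<in> I" "j \<in> I" "k \<in> I" for i j k
    using Cs[OF that] Ls[OF that] by (simp add: a_def)

  have T2: "torsion_norm2 A g n e D p = 1/2 * (\<Sum>i\<in>I. \<Sum>j\<in>I. \<Sum>k\<in>I. (T i j k)\<^sup>2)"
    unfolding torsion_norm2_def apply_metric_def
    by (intro arg_cong[of _ _ "(*) (1/2)"] sum.cong refl)
      (simp add: metric_frame_expansion[OF p Tt Tt] T_def power2_eq_square)
  have t2: "9/2 * norm2_3form n e (torsion_antisym A g D) p
      = 1/12 * (\<Sum>i\<in>I. \<Sum>j\<in>I. \<Sum>k\<in>I. (T j k i + T i j k + T k i j)\<^sup>2)"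
  proof -
    have "(torsion_antisym A g D (e i) (e j) (e k) p)\<^sup>2 = 1/9 * (T j k i + T i j k + T k i j)\<^sup>2"
      if I: "i \<in> I" "j \<in> I" "k \<in> I" for i j k
    proof -
      have "g p (e c p) (torsion A D (e a) (e b) p) = T a b c" if "a \<in> I" "b \<in> I" "c \<in> I" for a b c
        unfolding T_def using that by (intro metric_sym[OF metric] Tt frame_tangent p)
      then have "torsion_antisym A g D (e i) (e j) (e k) p = 1/3 * (T j k i + T i j k + T k i j)"
        using I by (simp only: torsion_antisym_def apply_metric_def)
      then have "(torsion_antisym A g D (e i) (e j) (e k) p)\<^sup>2
          = (1/3)\<^sup>2 * (T j k i + T i j k + T k i j)\<^sup>2"
        by (simp only: power_mult_distrib)
      then show ?thesis by (simp only: power_divide) simp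
    qed
    then have "(\<Sum>i\<in>I. \<Sum>j\<in>I. \<Sum>k\<in>I. (torsion_antisym A g D (e i) (e j) (e k) p)\<^sup>2) =
        (\<Sum>i\<in>I. \<Sum>j\<in>I. \<Sum>k\<in>I. 1/9 * (T j k i + T i j k + T k i j)\<^sup>2)"
      by (intro sum.cong refl)
    then show ?thesis unfolding norm2_3form_def sum_distrib_left[symmetric] by simp
  qed

  define c where "c k = (\<Sum>j\<in>I. C j j k)" for k
  define l where "l k = (\<Sum>j\<in>I. L j j k)" for k
  have \<theta>e: "\<theta> (e k) q = (\<Sum>j\<in>I. christoffel D j j k q + (-1) * christoffel LC j j k q)"
    if "k \<in> I" "q \<in> U" for k q
    using \<theta>[OF smooth_frame that(2)] that(1) by (simp add: christoffel_def)
  have \<theta>k: "\<theta> (e k) p = c k - l k" if "k \<in> I" for k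
    using \<theta>e[OF that p] by (simp add: c_def l_def C_def L_def sum_subtractf)
  have d\<theta>: "e i p (\<theta> (e i)) = (\<Sum>j\<in>I. e i p (christoffel D j j i)) - (\<Sum>j\<in>I. e i p (christoffel LC j j i))"
    if i: "i \<in> I" for i
  proof -
    note v = frame_tangent[OF i p]
    have s: "smooth_fun A U (\<lambda>q. christoffel D j j i q + (-1) * christoffel LC j j i q)" if "j \<in> I" for j
      by (intro smooth_fun_add_scaled[OF atlas open_U] christoffel_smooth D' LC' that i)
    have "e i p (\<theta> (e i)) = e i p (\<lambda>q. \<Sum>j\<in>I. christoffel D j j i q + (-1) * christoffel LC j j i q)"
      by (rule derivation_local[OF v smooth_fun_sum[OF atlas open_U s] open_U p]) (simp_all only: \<theta>e[OF i])
    also have "\<dots> = (\<Sum>j\<in>I. e i p (\<lambda>q. christoffel D j j i q + (-1) * christoffel LC j j i q))"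
      by (rule derivation_sum[OF atlas v s open_U p])
    also have "\<dots> = (\<Sum>j\<in>I. e i p (christoffel D j j i) + (-1) * e i p (christoffel LC j j i))"
      by (intro sum.cong refl derivation_add_scaled[OF atlas v _ _ open_U p] christoffel_smooth D' LC' i)
    finally show ?thesis by (simp add: sum_subtractf)
  qed
  have \<theta>L: "\<theta> (cov_deriv LC (e i) (e i)) p = (\<Sum>k\<in>I. L i i k * (c k - l k))" if i: "i \<in> I" for i
  proof -
    let ?X = "cov_deriv LC (e i) (e i)"
    have X: "smooth_vfield A U ?X" by (intro smooth_cov_deriv[OF LC' open_U] smooth_frame i)
    note Xt = smooth_vfield_tangent[OF X p]
    have "g p (E p (e j p) (e j)) (?X p) = (\<Sum>k\<in>I. christoffel E j j k p * L i i k)"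
      if "j \<in> I" "connection A E" for j E
      using metric_frame_expansion[OF p conn_tangent[OF that(2) open_U smooth_frame[OF that(1)] p
          frame_tangent[OF that(1) p]] Xt]
      by (simp add: christoffel_def L_def cov_deriv_def)
    then have "\<theta> ?X p = (\<Sum>j\<in>I. (\<Sum>k\<in>I. C j j k * L i i k) - (\<Sum>k\<in>I. L j j k * L i i k))"
      using \<theta>[OF X p] D' LC' by (simp add: C_def L_def)
    also have "\<dots> = (\<Sum>j\<in>I. \<Sum>k\<in>I. L i i k * (C j j k - L j j k))"
      by (simp add: sum_subtractf algebra_simps)
    also have "\<dots> = (\<Sum>k\<in>I. L i i k * (c k - l k))"
      unfolding c_def l_def sum_subtractf[symmetric] sum_distrib_left by (rule sum.swap)
    finally show ?thesis .
  qed
  have "(\<Sum>i\<in>I. \<theta> (cov_deriv LC (e i) (e i)) p) = (\<Sum>i\<in>I. \<Sum>k\<in>I. L i i k * (c k - l k))"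
    by (intro sum.cong refl \<theta>L)
  also have "\<dots> = (\<Sum>k\<in>I. l k * (c k - l k))"
    unfolding l_def sum_distrib_right by (rule sum.swap)
  finally have \<delta>: "codifferential n e LC \<theta> p =
      - ((\<Sum>i\<in>I. \<Sum>j\<in>I. e i p (christoffel D j j i)) - (\<Sum>i\<in>I. \<Sum>j\<in>I. e i p (christoffel LC j j i))
         - (\<Sum>k\<in>I. l k * (c k - l k)))"
    using d\<theta> unfolding codifferential_def by (simp add: sum_subtractf)
  have \<theta>2: "norm2_1form n e \<theta> p = (\<Sum>k\<in>I. (c k - l k)\<^sup>2)"
    unfolding norm2_1form_def by (intro sum.cong refl) (simp add: \<theta>k)
  (* The cross term l k * (c k - l k) sums to the zeroth-order part of the codifferential. *)
  have "(c k)\<^sup>2 = (l k)\<^sup>2 + 2 * (l k * (c k - l k)) + (c k - l k)\<^sup>2" for k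
    by (simp add: power2_eq_square algebra_simps)
  then have sq: "(\<Sum>k\<in>I. (c k)\<^sup>2) =
      (\<Sum>k\<in>I. (l k)\<^sup>2) + 2 * (\<Sum>k\<in>I. l k * (c k - l k)) + (\<Sum>k\<in>I. (c k - l k)\<^sup>2)"
    by (simp only: sum.distrib sum_distrib_left)
  have quad: "((\<Sum>i\<in>I. \<Sum>j\<in>I. \<Sum>k\<in>I. C i j k * C j i k)
        - (\<Sum>i\<in>I. \<Sum>j\<in>I. \<Sum>k\<in>I. (L i j k - L j i k) * C k j i))
      - ((\<Sum>i\<in>I. \<Sum>j\<in>I. \<Sum>k\<in>I. L i j k * L j i k)
        - (\<Sum>i\<in>I. \<Sum>j\<in>I. \<Sum>k\<in>I. (L i j k - L j i k) * L k j i))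
    = 1/2 * (\<Sum>i\<in>I. \<Sum>j\<in>I. \<Sum>k\<in>I. (T i j k)\<^sup>2)
      - 1/12 * (\<Sum>i\<in>I. \<Sum>j\<in>I. \<Sum>k\<in>I. (T j k i + T i j k + T k i j)\<^sup>2)"
    using contorsion_quadratic[where a = a and T = T and I = I, OF as T]
      connection_coefficients_quadratic[where C = C and L = L and I = I, OF Cs Ls]
    unfolding a_def by simp
  have sD: "2 * third_scalar A g n e D p = 2 * (\<Sum>i\<in>I. \<Sum>j\<in>I. e i p (christoffel D j j i))
      - (\<Sum>k\<in>I. (c k)\<^sup>2) + (\<Sum>i\<in>I. \<Sum>j\<in>I. \<Sum>k\<in>I. C i j k * C j i k)
      - (\<Sum>i\<in>I. \<Sum>j\<in>I. \<Sum>k\<in>I. (L i j k - L j i k) * C k j i)"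
    using scalar_curvature_frame[OF D LC p] by (simp add: third_scalar_def c_def C_def L_def)
  have sLC: "riemannian_scalar A g n e LC p = 2 * (\<Sum>i\<in>I. \<Sum>j\<in>I. e i p (christoffel LC j j i))
      - (\<Sum>k\<in>I. (l k)\<^sup>2) + (\<Sum>i\<in>I. \<Sum>j\<in>I. \<Sum>k\<in>I. L i j k * L j i k)
      - (\<Sum>i\<in>I. \<Sum>j\<in>I. \<Sum>k\<in>I. (L i j k - L j i k) * L k j i)"
    using scalar_curvature_frame[OF LCm LC p] by (simp add: riemannian_scalar_def l_def L_def)
  have combine: "s - r = T2 - t2 - 2 * (- (x - y - w)) - z"
    if "s = 2 * x - cc + a1 - a2" "r = 2 * y - ll + b1 - b2"
      "(a1 - a2) - (b1 - b2) = T2 - t2" "cc = ll + 2 * w + z"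
    for s r T2 t2 x y w z cc ll a1 a2 b1 b2 :: real
    using that by simp
  show ?thesis
    unfolding T2 t2 \<delta> \<theta>2 by (rule combine[OF sD sLC quad sq])
qed

end

section \<open>The trace of the torsion of the Chern connection\<close>

text \<open>The trace of \<open>Z \<mapsto> T(X,Z)\<close> is a sum of such terms. Differentiating \<open>g(Y,Y) = 1\<close> kills
  \<open>g(D\<^sub>X Y, Y)\<close> for both connections, and the derivatives of \<open>g(X,Y)\<close> along \<open>Y\<close> cancel between
  them.\<close>

lemma torsion_trace_term:
  assumes metric: "riemannian_metric A g" and D: "metric_connection A g D"
    and LC: "levi_civita_connection A g LC" and U: "open U" "p \<in> U"
    and X: "smooth_vfield A U X" and Y: "smooth_vfield A U Y"
    and unit: "\<And>q. q \<in> U \<Longrightarrow> g q (Y q) (Y q) = 1"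
  shows "g p (torsion A D X Y p) (Y p) = g p (D p (Y p) Y) (X p) - g p (LC p (Y p) Y) (X p)"
proof -
  note Xt = smooth_vfield_tangent[OF X U(2)] and Yt = smooth_vfield_tangent[OF Y U(2)]
  have half: "g p (E p (X p) Y) (Y p) = 0"
      "g p (E p (Y p) X) (Y p) = Y p (\<lambda>q. g q (X q) (Y q)) - g p (E p (Y p) Y) (X p)"
      "E p (X p) Y \<in> tangent_space A p" "E p (Y p) X \<in> tangent_space A p"
    if E: "metric_connection A g E" for E
  proof -
    have t: "E p v Z \<in> tangent_space A p" if "v \<in> tangent_space A p" "smooth_vfield A U Z" for v Z
      by (rule conn_tangent[OF metric_connection_imp_connection[OF E] U(1) that(2) U(2) that(1)])
    show "E p (X p) Y \<in> tangent_space A p" "E p (Y p) X \<in> tangent_space A p"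
      using t Xt Yt X Y by blast+
    have "X p (\<lambda>q. g q (Y q) (Y q)) = X p (\<lambda>q. 1)"
      by (rule derivation_local[OF Xt smooth_fun_const U]) (simp add: unit)
    then show "g p (E p (X p) Y) (Y p) = 0"
      using metric_connection_product[OF E U X Y Y] derivation_const[OF Xt]
        metric_sym[OF metric t[OF Xt Y] Yt] by simp
    show "g p (E p (Y p) X) (Y p) = Y p (\<lambda>q. g q (X q) (Y q)) - g p (E p (Y p) Y) (X p)"
      using metric_connection_product[OF E U Y X Y] metric_sym[OF metric t[OF Yt Y] Xt] by simp
  qed
  note d = half[OF D] and l = half[OF levi_civita_imp_metric[OF LC]]
  show ?thesis
    unfolding torsion_eq_difference[OF LC U X Y]
      metric_diff_left[OF metric tangent_diff[OF d(3,4)] tangent_diff[OF l(3,4)] Yt]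
      metric_diff_left[OF metric d(3,4) Yt] metric_diff_left[OF metric l(3,4) Yt] d(1,2) l(1,2)
    by simp
qed

locale chern_setting =
  fixes A :: "('a::{t2_space,second_countable_topology}, 'e::euclidean_space) chart set"
    and J :: "'a \<Rightarrow> 'a tvec \<Rightarrow> 'a tvec" and g :: "'a \<Rightarrow> 'a tvec \<Rightarrow> 'a tvec \<Rightarrow> real"
    and D LC :: "'a conn" and U :: "'a set"
  assumes atlas: "smooth_atlas A" and hermitian: "almost_hermitian A J g"
    and chern: "chern_connection A J g D" and levi_civita: "levi_civita_connection A g LC"
    and open_U: "open U"
begin

lemma metric: "riemannian_metric A g"
  using hermitian unfolding almost_hermitian_def by blast

lemma metric_conn: "metric_connection A g D"
  using chern unfolding chern_connection_def by blast

lemma conn: "connection A D" "connection A LC"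
  using metric_connection_imp_connection metric_conn levi_civita_imp_metric[OF levi_civita] by blast+

lemma smooth_J: "smooth_vfield A U X \<Longrightarrow> smooth_vfield A U (apply_field J X)"
  using hermitian open_U unfolding almost_hermitian_def almost_complex_structure_def by blast

lemma
  assumes "v \<in> tangent_space A p"
  shows J_tangent: "J p v \<in> tangent_space A p" and J_J: "J p (J p v) = - v"
    and metric_J_J: "w \<in> tangent_space A p \<Longrightarrow> g p (J p v) (J p w) = g p v w"
  using assms hermitian unfolding almost_hermitian_def almost_complex_structure_def by blast+

text \<open>\<open>J\<close> is an isometry with \<open>J\<^sup>2 = -1\<close>, hence skew.\<close>

lemma metric_J_left:
  assumes v: "v \<in> tangent_space A p" and w: "w \<in> tangent_space A p"
  shows "g p (J p v) w = - g p v (J p w)"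
  using metric_J_J[OF v J_tangent[OF w]] metric_uminus_right[OF metric w J_tangent[OF v]] J_J[OF w]
  by simp

lemma J_parallel:
  "p \<in> U \<Longrightarrow> smooth_vfield A U X \<Longrightarrow> smooth_vfield A U Y \<Longrightarrow>
    D p (X p) (apply_field J Y) = J p (D p (X p) Y)"
  using chern open_U unfolding chern_connection_def cov_deriv_def by blast

lemma torsion_tangent:
  assumes "p \<in> U" "smooth_vfield A U X" "smooth_vfield A U Y"
  shows "torsion A D X Y p \<in> tangent_space A p"
  unfolding torsion_eq_difference[OF levi_civita open_U assms]
  by (intro tangent_diff conn_tangent[OF conn(1) open_U] conn_tangent[OF conn(2) open_U]
      smooth_vfield_tangent[OF assms(2)] smooth_vfield_tangent[OF assms(3)] assms)

lemma torsion_swap: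
  assumes "p \<in> U" "smooth_vfield A U X" "smooth_vfield A U Y"
  shows "torsion A D Y X p = - torsion A D X Y p"
  using assms by (simp add: torsion_eq_difference[OF levi_civita open_U])

text \<open>As \<open>DF = 0\<close>, Cartan's formula only sees the difference between the bracket and its
  expression by \<open>D\<close>, which is the torsion. Writing \<open>g(Jv,w)\<close> as \<open>-g(v,Jw)\<close> keeps every term linear in
  the differentiated vector.\<close>

lemma ext_deriv_fundamental_form:
  assumes p: "p \<in> U" and X: "smooth_vfield A U X" and Y: "smooth_vfield A U Y"
    and Z: "smooth_vfield A U Z"
  shows "ext_deriv2 A (fundamental_form J g) X Y Z p =
    - (g p (torsion A D X Y p) (J p (Z p)) + g p (torsion A D Y Z p) (J p (X p))
       + g p (torsion A D Z X p) (J p (Y p)))"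
proof -
  have Dt: "E p (V p) W \<in> tangent_space A p"
    if "connection A E" "smooth_vfield A U V" "smooth_vfield A U W" for E V W
    by (rule conn_tangent[OF that(1) open_U that(3) p smooth_vfield_tangent[OF that(2) p]])
  have F: "V p (fundamental_form J g W W') =
      - g p (D p (V p) W) (J p (W' p)) + g p (D p (V p) W') (J p (W p))"
    if V: "smooth_vfield A U V" and W: "smooth_vfield A U W" and W': "smooth_vfield A U W'" for V W W'
  proof -
    note t = smooth_vfield_tangent[OF W p] smooth_vfield_tangent[OF W' p]
    have "V p (fundamental_form J g W W') = g p (J p (D p (V p) W)) (W' p) + g p (J p (W p)) (D p (V p) W')"
      using metric_connection_product[OF metric_conn open_U p V smooth_J[OF W] W'] J_parallel[OF p V W]
      by (simp add: fundamental_form_def apply_metric_def[abs_def] apply_field_def)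
    then show ?thesis
      using metric_J_left[OF Dt[OF conn(1) V W] t(2)]
        metric_sym[OF metric J_tangent[OF t(1)] Dt[OF conn(1) V W']] by simp
  qed
  have B: "- fundamental_form J g (lie_bracket A V W) W' p =
      - g p (torsion A D V W p) (J p (W' p)) + g p (D p (V p) W) (J p (W' p)) - g p (D p (W p) V) (J p (W' p))"
    if V: "smooth_vfield A U V" and W: "smooth_vfield A U W" and W': "smooth_vfield A U W'" for V W W'
  proof -
    note t = smooth_vfield_tangent[OF W' p]
    note dt = Dt[OF conn(1) V W] Dt[OF conn(1) W V] and lt = Dt[OF conn(2) V W] Dt[OF conn(2) W V]
    have Bt: "lie_bracket A V W p \<in> tangent_space A p"
      unfolding lie_bracket_eq_levi_civita[OF levi_civita open_U p V W] by (rule tangent_diff[OF lt])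
    have "torsion A D V W p = (D p (V p) W - D p (W p) V) - lie_bracket A V W p"
      by (simp add: torsion_def cov_deriv_def)
    then have "g p (torsion A D V W p) (J p (W' p)) = g p (D p (V p) W) (J p (W' p))
        - g p (D p (W p) V) (J p (W' p)) - g p (lie_bracket A V W p) (J p (W' p))"
      using metric_diff_left[OF metric tangent_diff[OF dt] Bt J_tangent[OF t]]
        metric_diff_left[OF metric dt J_tangent[OF t]] by simp
    then show ?thesis
      using metric_J_left[OF Bt t] by (simp add: fundamental_form_def apply_metric_def apply_field_def)
  qed
  show ?thesis
    using F[OF X Y Z] F[OF Y Z X] F[OF Z X Y] B[OF X Y Z] B[OF Y Z X] B[OF Z X Y]
    unfolding ext_deriv2_def by linarith
qed

lemma J_J_field: "smooth_vfield A U Y \<Longrightarrow> q \<in> U \<Longrightarrow> apply_field J (apply_field J Y) q = - Y q"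
  using J_J[OF smooth_vfield_tangent] by (simp add: apply_field_def)

text \<open>On the one hand \<open>T(JY,JJY) = T(JY,-Y) = T(Y,JY)\<close>, on the other hand \<open>T(JY,JJY) = -T(Y,JY)\<close> for
  the Chern connection.\<close>

lemma torsion_J_self:
  assumes p: "p \<in> U" and Y: "smooth_vfield A U Y"
  shows "torsion A D Y (apply_field J Y) p = 0"
proof -
  let ?Z = "apply_field J Y" let ?W = "apply_field J ?Z"
  note Z = smooth_J[OF Y] note W = smooth_J[OF Z]
  note t = smooth_vfield_tangent[OF Y p] smooth_vfield_tangent[OF Z p]
  have W1: "E p (Z' p) ?W = - E p (Z' p) Y" if "connection A E" "smooth_vfield A U Z'" for E Z'
    by (rule conn_uminus_field[OF atlas that(1) open_U p Y W smooth_vfield_tangent[OF that(2) p] J_J_field[OF Y]])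
  have W2: "E p (?W p) ?Z = - E p (Y p) ?Z" if "connection A E" for E
    unfolding J_J_field[OF Y p] by (rule conn_uminus_direction[OF that open_U p Z t(1)])
  have "torsion A D ?Z ?W p = torsion A D Y ?Z p"
    unfolding torsion_eq_difference[OF levi_civita open_U p Z W]
      torsion_eq_difference[OF levi_civita open_U p Y Z]
      W1[OF conn(1) Z] W1[OF conn(2) Z] W2[OF conn(1)] W2[OF conn(2)]
    by (simp add: fun_eq_iff)
  moreover have "torsion A D ?Z ?W p = - torsion A D Y ?Z p"
    using chern open_U p Y Z unfolding chern_connection_def by blast
  ultimately have "torsion A D Y ?Z p f = 0" for f by (simp add: fun_eq_iff)
  then show ?thesis by (simp add: fun_eq_iff)
qed

lemma torsion_form_summand:
  assumes p: "p \<in> U" and X: "smooth_vfield A U X" and Y: "smooth_vfield A U Y"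
  shows "ext_deriv2 A (fundamental_form J g) Y (apply_field J Y) X p =
    g p (torsion A D X Y p) (Y p)
    + g p (torsion A D X (apply_field J Y) p) (apply_field J Y p)"
proof -
  let ?Z = "apply_field J Y"
  note Z = smooth_J[OF Y]
  note t = smooth_vfield_tangent[OF Y p] smooth_vfield_tangent[OF X p]
  have "g p (torsion A D ?Z X p) (J p (Y p)) = - g p (torsion A D X ?Z p) (?Z p)"
    unfolding torsion_swap[OF p X Z]
    using metric_uminus_left[OF metric torsion_tangent[OF p X Z] J_tangent[OF t(1)]]
    by (simp add: apply_field_def)
  moreover have "g p (torsion A D X Y p) (J p (?Z p)) = - g p (torsion A D X Y p) (Y p)"
    using metric_uminus_right[OF metric t(1) torsion_tangent[OF p X Y]] J_J_field[OF Y p]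
    by (simp add: apply_field_def)
  ultimately show ?thesis
    unfolding ext_deriv_fundamental_form[OF p Y Z X] torsion_J_self[OF p Y]
    using metric_zero_left[OF metric J_tangent[OF t(2)]] by simp
qed

text \<open>With \<open>h(Y) = g(a\<^sub>Y Y, X)\<close>, where \<open>a = D - LC\<close>, the summands of \<open>\<Lambda>(dF)\<close> are \<open>h(e\<^sub>i) + h(Je\<^sub>i)\<close>. As \<open>h\<close> is
  even in \<open>Y\<close> and \<open>J\<close> maps each pair \<open>e\<^bsub>2\<alpha>-1\<^esub>, e\<^bsub>2\<alpha>\<^esub>\<close> to \<open>e\<^bsub>2\<alpha>\<^esub>, -e\<^bsub>2\<alpha>-1\<^esub>\<close>, both halves have the same
  sum.\<close>

lemma torsion_form_eq_trace:
  assumes frame: "adapted_frame A J g n U e" and p: "p \<in> U" and X: "smooth_vfield A U X"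
  shows "torsion_form A J g n e X p =
    (\<Sum>j=1..2*n. g p (D p (e j p) (e j)) (X p) - g p (LC p (e j p) (e j)) (X p))"
proof -
  define h where "h Y = g p (D p (Y p) Y) (X p) - g p (LC p (Y p) Y) (X p)" for Y
  note Xt = smooth_vfield_tangent[OF X p]
  have e: "smooth_vfield A U (e i)" if "i \<in> {1..2*n}" for i
    using frame that unfolding adapted_frame_def by blast
  have unit: "g q (e i q) (e i q) = 1" if "i \<in> {1..2*n}" "q \<in> U" for i q
    using frame that unfolding adapted_frame_def by simp
  have Je: "e (2*\<alpha>) q = J q (e (2*\<alpha> - 1) q)" if "\<alpha> \<in> {1..n}" "q \<in> U" for \<alpha> q
    using frame that unfolding adapted_frame_def by blast
  (* The frame relations hold only on U, so fields that agree there must have equal derivatives. *)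
  have h_local: "h Y = h Z"
    if Y: "smooth_vfield A U Y" and Z: "smooth_vfield A U Z" and eq: "\<And>q. q \<in> U \<Longrightarrow> Y q = Z q" for Y Z
    using conn_local[OF conn(1) open_U Y p _ Z] conn_local[OF conn(2) open_U Y p _ Z]
      eq smooth_vfield_tangent[OF Y p] p
    by (simp add: h_def)
  have h_uminus: "h Z = h Y"
    if Y: "smooth_vfield A U Y" and Z: "smooth_vfield A U Z" and eq: "\<And>q. q \<in> U \<Longrightarrow> Z q = - Y q" for Y Z
  proof -
    note t = smooth_vfield_tangent[OF Y p]
    have "E p (Z p) Z = E p (Y p) Y" if E: "connection A E" for E
    proof -
      have "E p (Z p) Z = - E p (Y p) Z"
        unfolding eq[OF p] by (rule conn_uminus_direction[OF E open_U p Z t])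
      also have "\<dots> = E p (Y p) Y"
        using conn_uminus_field[OF atlas E open_U p Y Z t eq] by simp
      finally show ?thesis .
    qed
    then show ?thesis using conn by (simp add: h_def)
  qed
  have pair: "h (apply_field J (e (2*\<alpha> - 1))) = h (e (2*\<alpha>))"
      "h (apply_field J (e (2*\<alpha>))) = h (e (2*\<alpha> - 1))" if \<alpha>: "\<alpha> \<in> {1..n}" for \<alpha>
  proof -
    have i: "2*\<alpha> \<in> {1..2*n}" "2*\<alpha> - 1 \<in> {1..2*n}" using \<alpha> by auto
    show "h (apply_field J (e (2*\<alpha> - 1))) = h (e (2*\<alpha>))"
      by (rule h_local[OF smooth_J[OF e[OF i(2)]] e[OF i(1)]]) (simp add: apply_field_def Je[OF \<alpha>])
    show "h (apply_field J (e (2*\<alpha>))) = h (e (2*\<alpha> - 1))"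
    proof (rule h_uminus[OF e[OF i(2)] smooth_J[OF e[OF i(1)]]])
      fix q assume "q \<in> U"
      then show "apply_field J (e (2*\<alpha>)) q = - e (2*\<alpha> - 1) q"
        using J_J[OF smooth_vfield_tangent[OF e[OF i(2)]]] by (simp add: apply_field_def Je[OF \<alpha>])
    qed
  qed
  have split: "(\<Sum>i=1..2*m. f i) = (\<Sum>\<alpha>=1..m. f (2*\<alpha> - 1) + f (2*\<alpha>))" for f :: "nat \<Rightarrow> real" and m
    by (induction m) (simp_all add: add.assoc)
  have J_frame: "(\<Sum>i=1..2*n. h (apply_field J (e i))) = (\<Sum>i=1..2*n. h (e i))"
    unfolding split by (intro sum.cong refl) (simp only: pair add.commute)
  have summand: "ext_deriv2 A (fundamental_form J g) (e i) (apply_field J (e i)) X p =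
      h (e i) + h (apply_field J (e i))" if i: "i \<in> {1..2*n}" for i
  proof -
    have trace: "g p (torsion A D X Y p) (Y p) = h Y"
      if "smooth_vfield A U Y" "\<And>q. q \<in> U \<Longrightarrow> g q (Y q) (Y q) = 1" for Y
      unfolding h_def by (rule torsion_trace_term[where g = g and Y = Y, OF metric metric_conn levi_civita open_U p X that])
    have "g q (apply_field J (e i) q) (apply_field J (e i) q) = 1" if q: "q \<in> U" for q
      using metric_J_J[OF smooth_vfield_tangent[OF e[OF i] q] smooth_vfield_tangent[OF e[OF i] q]]
        unit[OF i q] by (simp add: apply_field_def)
    then have "g p (torsion A D X (apply_field J (e i)) p) (apply_field J (e i) p) = h (apply_field J (e i))"
      using trace[OF smooth_J[OF e[OF i]]] by blast
    moreover have "g p (torsion A D X (e i) p) (e i p) = h (e i)"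
      using trace[OF e[OF i]] unit[OF i] by blast
    ultimately show ?thesis unfolding torsion_form_summand[OF p X e[OF i]] by simp
  qed
  have "torsion_form A J g n e X p = 1/2 * (\<Sum>i=1..2*n. h (e i) + h (apply_field J (e i)))"
    by (simp only: torsion_form_def summand cong: sum.cong)
  also have "\<dots> = (\<Sum>i=1..2*n. h (e i))" by (simp only: sum.distrib J_frame) simp
  finally show ?thesis unfolding h_def .
qed

end

theorem proposition2p2:
  fixes A :: "('a::{t2_space,second_countable_topology}, 'e::euclidean_space) chart set"
    and J :: "'a \<Rightarrow> 'a tvec \<Rightarrow> 'a tvec"
    and g :: "'a \<Rightarrow> 'a tvec \<Rightarrow> 'a tvec \<Rightarrow> real"
    and D LC :: "'a conn"
    and n :: nat and U :: "'a set" and e :: "nat \<Rightarrow> 'a vfield" and p :: 'a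
  assumes "smooth_atlas A" and "DIM('e) = 2 * n"
    and "almost_hermitian A J g"
    and "chern_connection A J g D"
    and "levi_civita_connection A g LC"
    and "adapted_frame A J g n U e" and "p \<in> U"
  shows "2 * third_scalar A g n e D p - riemannian_scalar A g n e LC p =
    torsion_norm2 A g n e D p
    - 9/2 * norm2_3form n e (torsion_antisym A g D) p
    - 2 * codifferential n e LC (torsion_form A J g n e) p
    - norm2_1form n e (torsion_form A J g n e) p"
proof -
  have "open U" using assms(6) unfolding adapted_frame_def by blast
  then interpret chern_setting A J g D LC U
    using assms(1,3,4,5) by unfold_locales
  interpret orthonormal_frame A g n U e
  proof
    fix i assume "i \<in> {1..2*n}"
    then show "smooth_vfield A U (e i)" using assms(6) unfolding adapted_frame_def by blast
  next
    fix q i j assume "q \<in> U" "i \<in> {1..2*n}" "j \<in> {1..2*n}"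
    then show "g q (e i q) (e j q) = (if i = j then 1 else 0)"
      using assms(6) unfolding adapted_frame_def by blast
  next
    fix q v assume "q \<in> U" "v \<in> tangent_space A q"
    then show "\<exists>a. v = (\<Sum>i=1..2*n. a i *\<^sub>t e i q)"
      using assms(6) unfolding adapted_frame_def by blast
  qed (rule atlas metric open_U)+
  show ?thesis
  proof (rule scalar_curvature_metric_connection)
    fix X q assume "smooth_vfield A U X" "q \<in> U"
    then show "torsion_form A J g n e X q =
        (\<Sum>j\<in>I. g q (D q (e j q) (e j)) (X q) - g q (LC q (e j q) (e j)) (X q))"
      by (intro torsion_form_eq_trace[OF assms(6)])
  qed (rule metric_conn assms(5,7))+
qed

end
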